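(* Let $G$ be a finitely generated abelian group and let $G=\langle A\mid R\rangle$ be any finite presentation of $G$, with $A=\{a_1,\dots,a_r\}$. Then there exists a constant $K$, depending only on the presentation, such that for every integer $n\geq 2$ $$D_{\mathrm{mean}}(n)\leq K\,n(\ln n)^2 \qquad\text{and}\qquad D_{\mathrm{smean}}(n)\leq K\,n(\ln n)^2 ,$$ where $D_{\mathrm{mean}}$ and $D_{\mathrm{smean}}$ are the mean Dehn function and the spherical mean Dehn function of the presentation.
   Context: Let $A=\{a_1,\dots,a_r\}$, let $A^*$ be the free monoid on $A\cup A^{-1}$ (its elements are possibly non-reduced words), and let $F$ be the free group on $A$. For a presentation $G=\langle A\mid R\rangle$ there are natural epimorphisms $A^*\to F\to G$. For $w\in A^*$, $|w|_A$ is the number of letters of $w$, and $w=_G 1$ means that $w$ maps to the identity of $G$. If $w=_G1$, then $\operatorname{area}(w)$ is the minimal $m\ge 0$ such that in $F$ one can write $w=\prod_{i=1}^m f_i^{-1}r_i^{\epsilon_i}f_i$ with $f_i\in F$, $r_i\in R$, $\epsilon_i=\pm1$. Put $B_G(n)=\{w\in A^*: w=_G1,\ |w|_A\le n\}$ and $S_G(n)=\{w\in A^*: w=_G1,\ |w|_A=n\}$. The mean Dehn function and spherical mean Dehn function of the presentation are $$D_{\mathrm{mean}}(n)=\frac{\sum_{w\in B_G(n)}\operatorname{area}(w)}{\sharp B_G(n)},\qquad D_{\mathrm{smean}}(n)=\frac{\sum_{w\in S_G(n)}\operatorname{area}(w)}{\sharp S_G(n)},$$ with $D_{\mathrm{smean}}(n)=0$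 if $S_G(n)=\emptyset$. Here $\ln$ is the natural logarithm. *)

theory Defs
  imports Complex_Main "HOL-Algebra.Generated_Groups"
begin

(* The letter (a, True) stands for the generator a, the letter (a, False) for its formal inverse. *)
type_synonym 'a letter = "'a \<times> bool"

definition inv_letter :: "'a letter \<Rightarrow> 'a letter" where
  "inv_letter x = (fst x, \<not> snd x)"

definition words :: "'a set \<Rightarrow> 'a letter list set" where
  "words A = lists (A \<times> UNIV)"

fun reduced :: "'a letter list \<Rightarrow> bool" where
  "reduced [] \<longleftrightarrow> True"
| "reduced [x] \<longleftrightarrow> True"
| "reduced (x # y # w) \<longleftrightarrow> y \<noteq> inv_letter x \<and> reduced (y # w)"

fun push_letter :: "'a letter \<Rightarrow> 'a letter list \<Rightarrow> 'a letter list" where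
  "push_letter x [] = [x]"
| "push_letter x (y # w) = (if y = inv_letter x then w else x # y # w)"

(* Free reduction; as a map from words A to the free group it is the natural epimorphism. *)
definition reduce :: "'a letter list \<Rightarrow> 'a letter list" where
  "reduce w = foldr push_letter w []"

definition free_group :: "'a set \<Rightarrow> 'a letter list monoid" where
  "free_group A =
     \<lparr>carrier = {w \<in> words A. reduced w}, mult = (\<lambda>u v. reduce (u @ v)), one = []\<rparr>"

definition normal_closure :: "('g, 'm) monoid_scheme \<Rightarrow> 'g set \<Rightarrow> 'g set" where
  "normal_closure G R = \<Inter> {N. N \<lhd> G \<and> R \<subseteq> N}"

definition presented_group :: "'a set \<Rightarrow> 'a letter list set \<Rightarrow> 'a letter list set monoid" where
  "presented_group A R = free_group A Mod normal_closure (free_group A) R"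

definition free_to_presented ::
  "'a set \<Rightarrow> 'a letter list set \<Rightarrow> 'a letter list \<Rightarrow> 'a letter list set" where
  "free_to_presented A R f = normal_closure (free_group A) R #>\<^bsub>free_group A\<^esub> f"

definition represents_one :: "'a set \<Rightarrow> 'a letter list set \<Rightarrow> 'a letter list \<Rightarrow> bool" where
  "represents_one A R w \<longleftrightarrow> free_to_presented A R (reduce w) = \<one>\<^bsub>presented_group A R\<^esub>"

(* Meaningful only for words that represent the identity of the presented group. *)
definition area :: "'a set \<Rightarrow> 'a letter list set \<Rightarrow> 'a letter list \<Rightarrow> nat" where
  "area A R w = (LEAST m. \<exists>xs :: ('a letter list \<times> 'a letter list \<times> int) list.
     length xs = m \<and>
     (\<forall>(f, r, e) \<in> set xs. f \<in> carrier (free_group A) \<and> r \<in> R \<and> (e = 1 \<or> e = -1)) \<and>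
     reduce w = foldr (\<otimes>\<^bsub>free_group A\<^esub>)
       (map (\<lambda>(f, r, e). inv\<^bsub>free_group A\<^esub> f \<otimes>\<^bsub>free_group A\<^esub> (r [^]\<^bsub>free_group A\<^esub> e)
                            \<otimes>\<^bsub>free_group A\<^esub> f) xs)
       \<one>\<^bsub>free_group A\<^esub>)"

definition null_ball :: "'a set \<Rightarrow> 'a letter list set \<Rightarrow> nat \<Rightarrow> 'a letter list set" where
  "null_ball A R n = {w \<in> words A. represents_one A R w \<and> length w \<le> n}"

definition null_sphere :: "'a set \<Rightarrow> 'a letter list set \<Rightarrow> nat \<Rightarrow> 'a letter list set" where
  "null_sphere A R n = {w \<in> words A. represents_one A R w \<and> length w = n}"

definition mean_dehn :: "'a set \<Rightarrow> 'a letter list set \<Rightarrow> nat \<Rightarrow> real" where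
  "mean_dehn A R n =
     (\<Sum>w \<in> null_ball A R n. real (area A R w)) / real (card (null_ball A R n))"

definition smean_dehn :: "'a set \<Rightarrow> 'a letter list set \<Rightarrow> nat \<Rightarrow> real" where
  "smean_dehn A R n =
     (if null_sphere A R n = {} then 0
      else (\<Sum>w \<in> null_sphere A R n. real (area A R w)) / real (card (null_sphere A R n)))"

lemma inv_letter_inv_letter [simp]: "inv_letter (inv_letter x) = x"
  by (simp add: inv_letter_def)

lemma reduced_Cons_D: "reduced (x # w) \<Longrightarrow> reduced w"
  by (cases w) auto

lemma reduced_push_letter: "reduced w \<Longrightarrow> reduced (push_letter x w)"
  by (cases w) (auto dest: reduced_Cons_D)

lemma reduced_foldr_push: "reduced v \<Longrightarrow> reduced (foldr push_letter w v)"
  by (induction w) (auto intro: reduced_push_letter)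

lemma reduced_reduce: "reduced (reduce w)"
  by (simp add: reduce_def reduced_foldr_push)

lemma push_letter_inv: "reduced w \<Longrightarrow> push_letter (inv_letter x) (push_letter x w) = w"
  by (cases w rule: reduced.cases) (auto simp: inv_letter_def)

lemma reduce_reduced: "reduced w \<Longrightarrow> reduce w = w"
proof (induction w)
  case Nil
  then show ?case by (simp add: reduce_def)
next
  case (Cons x w)
  then have "reduce w = w" by (auto dest: reduced_Cons_D)
  with Cons.prems show ?case by (cases w) (auto simp: reduce_def)
qed

lemma foldr_push_push:
  "reduced v \<Longrightarrow> foldr push_letter (push_letter x w) v = push_letter x (foldr push_letter w v)"
proof (cases w)
  case (Cons y u)
  assume v: "reduced v"
  show ?thesis
    using push_letter_inv[OF reduced_foldr_push[OF v, of u], of "inv_letter x"] Cons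
    by auto
qed simp

lemma foldr_push_reduce:
  "reduced v \<Longrightarrow> foldr push_letter (reduce w) v = foldr push_letter w v"
  by (induction w) (auto simp: reduce_def foldr_push_push)

lemma reduce_append_left: "reduce (reduce u @ v) = reduce (u @ v)"
  by (simp add: reduce_def foldr_push_reduce[unfolded reduce_def] reduced_foldr_push)

lemma reduce_append_right: "reduce (u @ reduce v) = reduce (u @ v)"
  using reduce_reduced[OF reduced_reduce[of v]] by (simp add: reduce_def)

lemma push_letter_in_words: "x \<in> A \<times> UNIV \<Longrightarrow> w \<in> words A \<Longrightarrow> push_letter x w \<in> words A"
  by (cases w) (auto simp: words_def)

lemma reduce_in_words: "w \<in> words A \<Longrightarrow> reduce w \<in> words A"
proof (induction w)
  case Nil
  then show ?case by (simp add: reduce_def)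
next
  case (Cons x w)
  then have "x \<in> A \<times> UNIV" "reduce w \<in> words A" by (auto simp: words_def)
  then show ?case using push_letter_in_words by (simp add: reduce_def)
qed

lemma reduce_in_free_group: "w \<in> words A \<Longrightarrow> reduce w \<in> carrier (free_group A)"
  by (simp add: free_group_def reduce_in_words reduced_reduce)

lemma reduce_inverse_append: "reduce (rev (map inv_letter w) @ w) = []"
proof (induction w)
  case (Cons x w)
  have "reduce (rev (map inv_letter (x # w)) @ x # w)
      = foldr push_letter (rev (map inv_letter w))
          (push_letter (inv_letter x) (push_letter x (reduce w)))"
    by (simp add: reduce_def)
  also have "\<dots> = reduce (rev (map inv_letter w) @ w)"
    by (simp only: push_letter_inv[OF reduced_reduce]) (simp add: reduce_def)
  finally show ?case using Cons.IH by simp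
qed (simp add: reduce_def)

lemma group_free_group: "group (free_group A)"
proof (rule groupI)
  fix u assume u: "u \<in> carrier (free_group A)"
  let ?v = "rev (map inv_letter u)"
  have "?v \<in> words A" using u by (fastforce simp: free_group_def words_def inv_letter_def)
  then have "reduce ?v \<in> carrier (free_group A)" by (rule reduce_in_free_group)
  moreover have "reduce ?v \<otimes>\<^bsub>free_group A\<^esub> u = \<one>\<^bsub>free_group A\<^esub>"
    by (simp add: free_group_def reduce_append_left reduce_inverse_append)
  ultimately show "\<exists>v \<in> carrier (free_group A). v \<otimes>\<^bsub>free_group A\<^esub> u = \<one>\<^bsub>free_group A\<^esub>"
    by blast
next
  fix u v assume "u \<in> carrier (free_group A)" "v \<in> carrier (free_group A)"
  then have "u @ v \<in> words A" by (auto simp: free_group_def words_def)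
  from reduce_in_free_group[OF this]
  show "u \<otimes>\<^bsub>free_group A\<^esub> v \<in> carrier (free_group A)" by (simp add: free_group_def)
qed (auto simp: free_group_def words_def reduce_append_left reduce_append_right reduce_reduced)

lemma normal_normal_closure:
  assumes "group G" "R \<subseteq> carrier G"
  shows "normal_closure G R \<lhd> G"
proof -
  interpret group G by fact
  have "carrier G \<lhd> G"
    by (simp add: normal_inv_iff subgroup_self)
  then have ne: "{N. N \<lhd> G \<and> R \<subseteq> N} \<noteq> {}"
    using assms(2) by blast
  have "subgroup (normal_closure G R) G"
    unfolding normal_closure_def using ne
    by (intro subgroups_Inter) (auto simp: normal_imp_subgroup)
  then show ?thesis
    unfolding normal_inv_iff by (auto simp: normal_closure_def normal_inv_iff)
qed

lemma group_presented_group: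
  "R \<subseteq> carrier (free_group A) \<Longrightarrow> group (presented_group A R)"
  unfolding presented_group_def
  by (intro normal.factorgroup_is_group normal_normal_closure group_free_group)

end

theory Submission
  imports Defs "HOL-Library.Multiset"
begin

text \<open>
  In an abelian group a null word stays null when its letters are permuted, so the letters of a
  uniformly random null word of length n are exchangeable. A homomorphism from G to the integers
  sums to 0 over such a word, hence its values at two different letters are negatively correlated,
  and on a segment of length m its second moment is O(m). Finitely many homomorphisms control the
  word length in G up to a constant, so the expected squared length of a shortest word for the
  segment is O(m) as well. Since the Dehn function is at most quadratic, merging two adjacent
  segments of length m costs an expected area O(m). Merging along a dyadic tree of depth
  log n therefore fills the word with expected area O(n ln n).
\<close>

section \<open>Areas of null words\<close>

text \<open>Conditioning on nullity destroys the independence of the letters. Exchangeability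
  replaces it, and pair correlations suffice because a quadratic area bound calls for exactly the
  mean of a squared length. A proper segment w need not be null, so it has no area of its own. Its
  cost is the area of \<open>w @ winv (nf w)\<close>, where \<open>nf w\<close> represents the same
  element and has length controlled by homomorphisms. Merging two segments then only requires
  filling the null word made of three such normal forms. The presentation is arbitrary: commutators
  of letters need not be relators, and the group may have torsion. The former affects constants
  only, since there are finitely many pairs of letters. The latter is invisible to homomorphisms to
  the integers and adds a bounded length to the normal forms. Means appear as sums over one sphere
  compared with its cardinality, which covers empty spheres as well. The resulting n ln n is relaxed
  to the stated n (ln n)^2 at the very end.\<close>

inductive conj_prod :: "('g, 'm) monoid_scheme \<Rightarrow> 'g set \<Rightarrow> nat \<Rightarrow> 'g \<Rightarrow> bool"
  for G :: "('g, 'm) monoid_scheme" (structure) and R where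
  one: "conj_prod G R 0 \<one>"
| step: "\<lbrakk>f \<in> carrier G; r \<in> R; e = 1 \<or> e = -1; conj_prod G R m g\<rbrakk>
    \<Longrightarrow> conj_prod G R (Suc m) (inv f \<otimes> (r [^] (e::int)) \<otimes> f \<otimes> g)"

text \<open>Bridge to the list of triples in \<open>area\<close>; closure properties then follow by
  rule induction on \<open>conj_prod\<close>.\<close>

lemma conj_prod_iff:
  "conj_prod G R m g \<longleftrightarrow> (\<exists>xs :: ('g \<times> 'g \<times> int) list.
     length xs = m \<and>
     (\<forall>(f, r, e) \<in> set xs. f \<in> carrier G \<and> r \<in> R \<and> (e = 1 \<or> e = -1)) \<and>
     g = foldr (\<otimes>\<^bsub>G\<^esub>)
       (map (\<lambda>(f, r, e). inv\<^bsub>G\<^esub> f \<otimes>\<^bsub>G\<^esub> (r [^]\<^bsub>G\<^esub> e) \<otimes>\<^bsub>G\<^esub> f) xs) \<one>\<^bsub>G\<^esub>)"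
  (is "_ \<longleftrightarrow> (\<exists>xs. ?P m g xs)") for G :: "('g, 'm) monoid_scheme"
proof
  show "conj_prod G R m g \<Longrightarrow> \<exists>xs. ?P m g xs"
  proof (induction rule: conj_prod.induct)
    case (step f r e m g)
    then obtain xs where "?P m g xs" by blast
    with step.hyps show ?case by (intro exI[of _ "(f, r, e) # xs"]) auto
  qed simp
  have "?P m g xs \<Longrightarrow> conj_prod G R m g" for xs
  proof (induction xs arbitrary: m g)
    case (Cons x xs)
    obtain f r e where x: "x = (f, r, e)" by (cases x)
    with Cons show ?case by (auto intro!: conj_prod.step)
  qed (auto intro: conj_prod.one)
  then show "\<exists>xs. ?P m g xs \<Longrightarrow> conj_prod G R m g" by blast
qed

context group
begin

context
  fixes R assumes R: "R \<subseteq> carrier G"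
begin

lemma conj_prod_closed: "conj_prod G R m g \<Longrightarrow> g \<in> carrier G"
  by (induction rule: conj_prod.induct) (use R in auto)

lemma conj_prod_mult:
  assumes "conj_prod G R m g" "conj_prod G R n h"
  shows "conj_prod G R (m + n) (g \<otimes> h)"
  using assms(1)
proof (induction rule: conj_prod.induct)
  case one
  then show ?case using assms(2) conj_prod_closed by simp
next
  case (step f r e m g)
  have "inv f \<otimes> r [^] e \<otimes> f \<otimes> g \<otimes> h = inv f \<otimes> r [^] e \<otimes> f \<otimes> (g \<otimes> h)"
    using step.hyps R assms(2) conj_prod_closed by (intro m_assoc) auto
  then show ?case using conj_prod.step[OF step.hyps(1-3) step.IH] by simp
qed

lemma conj_prod_single:
  "\<lbrakk>f \<in> carrier G; r \<in> R; e = 1 \<or> e = -1\<rbrakk> \<Longrightarrow> conj_prod G R 1 (inv f \<otimes> (r [^] (e::int)) \<otimes> f)"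
  using conj_prod.step[OF _ _ _ conj_prod.one, of f G r R e] R by auto

text \<open>Conjugation by x distributes over the factors and turns each conjugator f into
  \<open>f \<otimes> inv x\<close>, so the number of factors is unchanged.\<close>

lemma conj_prod_conj:
  assumes "conj_prod G R m g" "x \<in> carrier G"
  shows "conj_prod G R m (x \<otimes> g \<otimes> inv x)"
  using assms(1)
proof (induction rule: conj_prod.induct)
  case one
  then show ?case using assms(2) by (simp add: conj_prod.one)
next
  case (step f r e m g)
  have g: "g \<in> carrier G" using step.hyps conj_prod_closed by blast
  have r: "r \<in> carrier G" using step.hyps R by blast
  note f = step.hyps(1) and x = assms(2)
  have l_inv_cancel: "inv x \<otimes> (x \<otimes> y) = y" if "y \<in> carrier G" for y
    using x that by (simp add: m_assoc[symmetric])
  have "x \<otimes> (inv f \<otimes> r [^] e \<otimes> f \<otimes> g) \<otimes> inv x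
      = inv (f \<otimes> inv x) \<otimes> r [^] e \<otimes> (f \<otimes> inv x) \<otimes> (x \<otimes> g \<otimes> inv x)"
    using f x g r l_inv_cancel by (simp add: m_assoc inv_mult_group)
  then show ?case using conj_prod.step[OF _ step.hyps(2,3) step.IH, of "f \<otimes> inv x"] f x by simp
qed

text \<open>Inversion flips each exponent e and reverses the order of the factors, hence the appeal
  to \<open>conj_prod_mult\<close> to append on the right.\<close>

lemma conj_prod_inv:
  assumes "conj_prod G R m g"
  shows "conj_prod G R m (inv g)"
  using assms
proof (induction rule: conj_prod.induct)
  case one
  then show ?case by (simp add: conj_prod.one)
next
  case (step f r e m g)
  have g: "g \<in> carrier G" using step.hyps conj_prod_closed by blast
  have r: "r \<in> carrier G" using step.hyps R by blast
  note f = step.hyps(1)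
  have "inv (inv f \<otimes> r [^] e \<otimes> f \<otimes> g) = inv g \<otimes> (inv f \<otimes> r [^] (- e) \<otimes> f)"
    using f g r by (simp add: m_assoc inv_mult_group int_pow_neg)
  moreover have "conj_prod G R (m + 1) (inv g \<otimes> (inv f \<otimes> r [^] (- e) \<otimes> f))"
    using step.hyps by (intro conj_prod_mult step.IH conj_prod_single) auto
  ultimately show ?case by simp
qed

text \<open>The products of conjugates form a normal subgroup containing R. Consequently the
  \<open>LEAST\<close> in \<open>area\<close> is attained for null words.\<close>

lemma normal_closure_conj_prod:
  assumes "g \<in> normal_closure G R"
  shows "\<exists>m. conj_prod G R m g"
proof -
  let ?N = "{g. \<exists>m. conj_prod G R m g}"
  have "subgroup ?N G"
    by (rule subgroupI)
      (auto intro: conj_prod_closed conj_prod.one conj_prod_mult conj_prod_inv)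
  then have "?N \<lhd> G"
    unfolding normal_inv_iff using conj_prod_conj by blast
  moreover have "R \<subseteq> ?N"
    using conj_prod_single[OF one_closed, of _ 1] R by (fastforce simp: int_pow_1)
  ultimately show ?thesis using assms unfolding normal_closure_def by blast
qed

end

end

section \<open>Formal inverses of unreduced words\<close>

definition winv :: "'a letter list \<Rightarrow> 'a letter list" where
  "winv w = rev (map inv_letter w)"

lemma winv_simps [simp]:
  "winv [] = []" "winv (x # w) = winv w @ [inv_letter x]" "winv (u @ v) = winv v @ winv u"
  "length (winv w) = length w"
  by (simp_all add: winv_def)

lemma fst_inv_letter [simp]: "fst (inv_letter x) = fst x"
  by (simp add: inv_letter_def)

lemma Nil_in_words [simp]: "[] \<in> words A"
  by (simp add: words_def)

lemma Cons_in_words [simp]: "x # w \<in> words A \<longleftrightarrow> fst x \<in> A \<and> w \<in> words A"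
  by (cases x) (simp add: words_def)

lemma append_in_words [simp]: "u @ v \<in> words A \<longleftrightarrow> u \<in> words A \<and> v \<in> words A"
  by (simp add: words_def)

lemma in_words_iff: "w \<in> words A \<longleftrightarrow> fst ` set w \<subseteq> A"
  by (induction w) auto

lemma winv_in_words [simp]: "winv w \<in> words A \<longleftrightarrow> w \<in> words A"
  by (induction w) auto

lemma winv_winv [simp]: "winv (winv w) = w"
  by (induction w) auto

lemma reduce_append: "reduce (u @ v) = reduce u \<otimes>\<^bsub>free_group A\<^esub> reduce v"
  by (simp add: free_group_def reduce_append_left reduce_append_right)

lemma reduce_winv:
  assumes "w \<in> words A"
  shows "reduce (winv w) = inv\<^bsub>free_group A\<^esub> reduce w"
proof -
  interpret group "free_group A" by (rule group_free_group)
  have "reduce (winv w) \<otimes>\<^bsub>free_group A\<^esub> reduce w = \<one>\<^bsub>free_group A\<^esub>"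
    using reduce_inverse_append[of w, folded winv_def] by (simp add: reduce_append[symmetric]) (simp add: free_group_def)
  then show ?thesis using assms by (intro inv_equality[symmetric] reduce_in_free_group) auto
qed

lemma area_eq: "area A R w = (LEAST m. conj_prod (free_group A) R m (reduce w))"
  unfolding area_def conj_prod_iff ..

text \<open>Commutativity is expressed inside the free group, so that all later arguments can
  compute with words.\<close>

locale abelian_presentation =
  fixes A :: "'a set" and R :: "'a letter list set"
  assumes finite_A: "finite A"
    and relators: "R \<subseteq> carrier (free_group A)"
    and commutator_in_normal_closure: "\<lbrakk>x \<in> carrier (free_group A); y \<in> carrier (free_group A)\<rbrakk> \<Longrightarrow>
      x \<otimes>\<^bsub>free_group A\<^esub> y \<otimes>\<^bsub>free_group A\<^esub> inv\<^bsub>free_group A\<^esub> x \<otimes>\<^bsub>free_group A\<^esub> inv\<^bsub>free_group A\<^esub> y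
        \<in> normal_closure (free_group A) R"
begin

sublocale F: group "free_group A"
  by (rule group_free_group)

definition null :: "'a letter list \<Rightarrow> bool" where
  "null w \<longleftrightarrow> w \<in> words A \<and> represents_one A R w"

lemma null_iff: "null w \<longleftrightarrow> w \<in> words A \<and> reduce w \<in> normal_closure (free_group A) R"
proof -
  let ?N = "normal_closure (free_group A) R"
  have N: "subgroup ?N (free_group A)"
    using normal_normal_closure[OF group_free_group relators] by (rule normal_imp_subgroup)
  have "represents_one A R w \<longleftrightarrow> ?N #>\<^bsub>free_group A\<^esub> reduce w = ?N"
    by (simp add: represents_one_def free_to_presented_def presented_group_def FactGroup_def)
  moreover have "\<dots> \<longleftrightarrow> reduce w \<in> ?N" if "w \<in> words A"
    using F.coset_join1[OF _ reduce_in_free_group[OF that] N] F.coset_join2[OF reduce_in_free_group[OF that] N]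
    by blast
  ultimately show ?thesis unfolding null_def by blast
qed

lemma null_in_words: "null w \<Longrightarrow> w \<in> words A"
  by (simp add: null_def)

lemma null_conj_prod_area:
  assumes "null w"
  shows "conj_prod (free_group A) R (area A R w) (reduce w)"
proof -
  have "\<exists>m. conj_prod (free_group A) R m (reduce w)"
    using assms F.normal_closure_conj_prod[OF relators] by (simp add: null_iff)
  then show ?thesis unfolding area_eq by (rule LeastI_ex)
qed

lemma area_le: "conj_prod (free_group A) R m (reduce w) \<Longrightarrow> area A R w \<le> m"
  unfolding area_eq by (rule Least_le)

lemma normal_closure_relators: "normal_closure (free_group A) R \<lhd> free_group A"
  by (rule normal_normal_closure[OF group_free_group relators])

lemma null_append: "\<lbrakk>null u; null v\<rbrakk> \<Longrightarrow> null (u @ v)"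
  using subgroup.m_closed[OF normal_imp_subgroup[OF normal_closure_relators]]
  by (simp add: null_iff reduce_append[of _ _ A])

lemma area_append: "\<lbrakk>null u; null v\<rbrakk> \<Longrightarrow> area A R (u @ v) \<le> area A R u + area A R v"
  using F.conj_prod_mult[OF relators null_conj_prod_area null_conj_prod_area]
  by (intro area_le) (simp add: reduce_append[of _ _ A])

lemma null_winv: "null u \<Longrightarrow> null (winv u)"
  using subgroup.m_inv_closed[OF normal_imp_subgroup[OF normal_closure_relators]]
  by (simp add: null_iff reduce_winv[of _ A])

lemma area_winv: "null u \<Longrightarrow> area A R (winv u) \<le> area A R u"
  using F.conj_prod_inv[OF relators null_conj_prod_area]
  by (intro area_le) (simp add: reduce_winv[of _ A] null_in_words)

lemma null_conj: "\<lbrakk>null u; v \<in> words A\<rbrakk> \<Longrightarrow> null (v @ u @ winv v)"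
  using F.normal_inv_iff normal_closure_relators
  by (simp add: null_iff reduce_winv reduce_append[of _ _ A] reduce_in_free_group F.m_assoc[symmetric])

lemma area_conj: "\<lbrakk>null u; v \<in> words A\<rbrakk> \<Longrightarrow> area A R (v @ u @ winv v) \<le> area A R u"
  using F.conj_prod_conj[OF relators null_conj_prod_area, of u "reduce v"]
  by (intro area_le)
    (simp add: reduce_winv reduce_append[of _ _ A] reduce_in_free_group F.m_assoc null_in_words)

lemma null_commutator: "\<lbrakk>u \<in> words A; v \<in> words A\<rbrakk> \<Longrightarrow> null (u @ v @ winv u @ winv v)"
  using commutator_in_normal_closure[of "reduce u" "reduce v"]
  by (simp add: null_iff reduce_winv reduce_append[of _ _ A] reduce_in_free_group F.m_assoc)

lemma null_Nil: "null []"
  using subgroup.one_closed[OF normal_imp_subgroup[OF normal_closure_relators]]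
  by (simp add: null_iff reduce_def free_group_def)

lemma area_Nil [simp]: "area A R [] = 0"
  using conj_prod.one[of "free_group A" R] area_le[of 0 "[]"]
  by (simp add: reduce_def free_group_def)

lemma null_cong: "\<lbrakk>null u; v \<in> words A; reduce u = reduce v\<rbrakk> \<Longrightarrow> null v"
  by (simp add: null_iff)

lemma area_cong: "reduce u = reduce v \<Longrightarrow> area A R u = area A R v"
  by (simp add: area_eq)

end

section \<open>Words with equal exponent sums\<close>

lemma reduce_cancel:
  "reduce (p @ winv v @ v @ q) = reduce (p @ q)" "reduce (p @ v @ winv v @ q) = reduce (p @ q)"
proof -
  have *: "reduce (p @ winv v @ v @ q) = reduce (p @ q)" for v
  proof -
    have "reduce (winv v @ v @ q) = reduce q"
      using reduce_append_left[of "winv v @ v" q] reduce_inverse_append[of v]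
      by (simp add: winv_def)
    then show ?thesis by (metis reduce_append_right)
  qed
  show "reduce (p @ winv v @ v @ q) = reduce (p @ q)" by (rule *)
  show "reduce (p @ v @ winv v @ q) = reduce (p @ q)" using *[of "winv v"] by simp
qed

definition letter_exp :: "'a letter \<Rightarrow> 'a \<Rightarrow> int" where
  "letter_exp x a = (if fst x = a then if snd x then 1 else -1 else 0)"

definition word_exp :: "'a letter list \<Rightarrow> 'a \<Rightarrow> int" where
  "word_exp w a = (\<Sum>x\<leftarrow>w. letter_exp x a)"

lemma letter_exp_inv_letter [simp]: "letter_exp (inv_letter x) a = - letter_exp x a"
  by (simp add: letter_exp_def inv_letter_def)

lemma word_exp_simps [simp]:
  "word_exp [] a = 0" "word_exp (x # w) a = letter_exp x a + word_exp w a"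
  "word_exp (u @ v) a = word_exp u a + word_exp v a"
  by (simp_all add: word_exp_def)

lemma word_exp_winv [simp]: "word_exp (winv w) a = - word_exp w a"
  by (induction w) auto

lemma sum_abs_word_exp_le:
  assumes "finite A"
  shows "(\<Sum>a\<in>A. \<bar>word_exp w a\<bar>) \<le> int (length w)"
proof (induction w)
  case (Cons x w)
  have "(\<Sum>a\<in>A. \<bar>letter_exp x a\<bar>) = (\<Sum>a\<in>A. if fst x = a then 1 else 0)"
    by (intro sum.cong) (auto simp: letter_exp_def)
  also have "\<dots> \<le> 1" using assms by simp
  finally have "(\<Sum>a\<in>A. \<bar>letter_exp x a\<bar>) \<le> 1" .
  moreover have "(\<Sum>a\<in>A. \<bar>word_exp (x # w) a\<bar>) \<le> (\<Sum>a\<in>A. \<bar>letter_exp x a\<bar> + \<bar>word_exp w a\<bar>)"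
    by (intro sum_mono) (simp add: abs_triangle_ineq)
  ultimately show ?case using Cons.IH by (simp add: sum.distrib)
qed simp

definition wpow :: "'a \<Rightarrow> int \<Rightarrow> 'a letter list" where
  "wpow a k = replicate (nat \<bar>k\<bar>) (a, k \<ge> 0)"

lemma word_exp_replicate [simp]: "word_exp (replicate n x) a = int n * letter_exp x a"
  by (induction n) (auto simp: algebra_simps)

lemma word_exp_wpow [simp]: "word_exp (wpow a k) b = (if a = b then k else 0)"
  by (auto simp: wpow_def letter_exp_def)

lemma wpow_in_words: "a \<in> A \<Longrightarrow> wpow a k \<in> words A"
  by (auto simp: wpow_def in_words_iff)

lemma reduce_Cons_wpow:
  "reduce ((a, b) # wpow a k) = reduce (wpow a (k + (if b then 1 else -1)))"
proof -
  have cancel: "reduce ((a, b) # (a, \<not> b) # w) = reduce w" for w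
    using reduce_cancel(2)[of "[]" "[(a, b)]" w] by (simp add: inv_letter_def)
  \<comment> \<open>The letter lengthens the power or cancels its first letter. For a negative
    letter k = 0 is separate: there is nothing to cancel, and a negative power begins.\<close>
  consider "b" "k \<ge> 0" | "\<not> b" "k < 0" | "\<not> b" "k = 0" | "b" "k < 0" | "\<not> b" "k > 0" by linarith
  then show ?thesis
  proof cases
    case 1
    then show ?thesis by (simp add: wpow_def nat_add_distrib)
  next
    case 2
    then have "nat \<bar>k - 1\<bar> = Suc (nat \<bar>k\<bar>)" by simp
    with 2 show ?thesis by (simp add: wpow_def)
  next
    case 3
    then show ?thesis by (simp add: wpow_def)
  next
    case 4
    then have "nat \<bar>k\<bar> = Suc (nat \<bar>k + 1\<bar>)" by simp
    with 4 cancel show ?thesis by (cases "k = -1") (simp_all add: wpow_def)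
  next
    case 5
    then have "nat \<bar>k\<bar> = Suc (nat \<bar>k - 1\<bar>)" by simp
    with 5 cancel show ?thesis by (simp add: wpow_def)
  qed
qed

text \<open>For distinct \<open>xs\<close> this is the normal form of the free abelian group on
  \<open>xs\<close>.\<close>

definition exp_word :: "'a list \<Rightarrow> ('a \<Rightarrow> int) \<Rightarrow> 'a letter list" where
  "exp_word xs v = concat (map (\<lambda>a. wpow a (v a)) xs)"

lemma exp_word_simps [simp]:
  "exp_word [] v = []" "exp_word (a # xs) v = wpow a (v a) @ exp_word xs v"
  "exp_word (xs @ ys) v = exp_word xs v @ exp_word ys v"
  by (simp_all add: exp_word_def)

lemma exp_word_cong: "(\<And>a. a \<in> set xs \<Longrightarrow> u a = v a) \<Longrightarrow> exp_word xs u = exp_word xs v"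
  by (induction xs) auto

lemma exp_word_in_words: "set xs \<subseteq> A \<Longrightarrow> exp_word xs v \<in> words A"
  by (induction xs) (auto simp: wpow_in_words)

lemma exp_word_zero [simp]: "exp_word xs (\<lambda>a. 0) = []"
  by (induction xs) (auto simp: wpow_def)

lemma word_exp_exp_word:
  "distinct xs \<Longrightarrow> word_exp (exp_word xs v) a = (if a \<in> set xs then v a else 0)"
  by (induction xs) auto

lemma length_exp_word:
  "distinct xs \<Longrightarrow> int (length (exp_word xs v)) = (\<Sum>a\<in>set xs. \<bar>v a\<bar>)"
  by (induction xs) (auto simp: wpow_def)

definition wpower :: "'a letter list \<Rightarrow> int \<Rightarrow> 'a letter list" where
  "wpower w k = concat (replicate (nat \<bar>k\<bar>) (if k \<ge> 0 then w else winv w))"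

lemma word_exp_concat_replicate: "word_exp (concat (replicate n w)) a = int n * word_exp w a"
  by (induction n) (auto simp: algebra_simps)

lemma word_exp_wpower [simp]: "word_exp (wpower w k) a = k * word_exp w a"
  by (simp add: wpower_def word_exp_concat_replicate)

lemma length_wpower: "int (length (wpower w k)) = \<bar>k\<bar> * int (length w)"
  by (simp add: wpower_def length_concat sum_list_replicate)

section \<open>Rewriting words at a controlled area\<close>

context abelian_presentation
begin

text \<open>Equality in the presented group together with a bound m on the cost of rewriting u into
  v; costs add along chains of rewritings.\<close>

definition eqv :: "nat \<Rightarrow> 'a letter list \<Rightarrow> 'a letter list \<Rightarrow> bool" where
  "eqv m u v \<longleftrightarrow> null (u @ winv v) \<and> area A R (u @ winv v) \<le> m"

lemma eqv_in_words: "eqv m u v \<Longrightarrow> u \<in> words A \<and> v \<in> words A"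
  by (auto simp: eqv_def dest: null_in_words)

lemma eqv_mono: "eqv m u v \<Longrightarrow> m \<le> n \<Longrightarrow> eqv n u v"
  by (simp add: eqv_def)

lemma eqv_reduce:
  assumes "u \<in> words A" "v \<in> words A" "reduce u = reduce v"
  shows "eqv m u v"
proof -
  have "reduce (u @ winv v) = reduce []"
    using reduce_cancel(2)[of "[]" v "[]"] reduce_append_left[of u "winv v"]
      reduce_append_left[of v "winv v"] assms by simp
  then show ?thesis
    using assms null_cong[OF null_Nil, of "u @ winv v"] area_cong[of "u @ winv v" "[]"]
    by (simp add: eqv_def)
qed

lemma eqv_trans:
  assumes "eqv m u v" "eqv n v z"
  shows "eqv (m + n) u z"
proof -
  have r: "reduce ((u @ winv v) @ (v @ winv z)) = reduce (u @ winv z)"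
    using reduce_cancel(1)[of u v "winv z"] by simp
  have "null ((u @ winv v) @ (v @ winv z))"
    using assms null_append unfolding eqv_def by blast
  moreover have "u @ winv z \<in> words A" using assms eqv_in_words by simp
  ultimately have "null (u @ winv z)" using r by (rule null_cong)
  moreover have "area A R (u @ winv z) \<le> m + n"
    using area_append[of "u @ winv v" "v @ winv z"] assms area_cong[OF r] by (simp add: eqv_def)
  ultimately show ?thesis by (simp add: eqv_def)
qed

lemma eqv_sym: "eqv m u v \<Longrightarrow> eqv m v u"
  using null_winv[of "u @ winv v"] area_winv[of "u @ winv v"] by (auto simp: eqv_def)

text \<open>The suffix q cancels freely and the prefix p only conjugates \<open>u @ winv v\<close>,
  so rewriting a subword costs nothing extra.\<close>

lemma eqv_context:
  assumes "eqv m u v" "p \<in> words A" "q \<in> words A"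
  shows "eqv m (p @ u @ q) (p @ v @ q)"
proof -
  have r: "reduce (p @ (u @ winv v) @ winv p) = reduce ((p @ u @ q) @ winv (p @ v @ q))"
    using reduce_cancel(2)[of "p @ u" q "winv v @ winv p"] by simp
  have "null (p @ (u @ winv v) @ winv p)"
    using assms unfolding eqv_def by (intro null_conj) auto
  moreover have "(p @ u @ q) @ winv (p @ v @ q) \<in> words A" using assms eqv_in_words by simp
  ultimately have "null ((p @ u @ q) @ winv (p @ v @ q))" using r by (rule null_cong)
  moreover have "area A R ((p @ u @ q) @ winv (p @ v @ q)) \<le> m"
    using area_conj[of "u @ winv v" p] assms area_cong[OF r] by (simp add: eqv_def)
  ultimately show ?thesis by (simp add: eqv_def)
qed

lemma null_eqv_iff: "null w \<longleftrightarrow> (\<exists>m. eqv m w [])"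
  by (auto simp: eqv_def)

lemma eqv_null: "eqv m u v \<Longrightarrow> null u \<longleftrightarrow> null v"
  unfolding null_eqv_iff by (meson eqv_sym eqv_trans)

lemma null_area_eqv: "null w \<Longrightarrow> eqv (area A R w) w []"
  by (simp add: eqv_def)

lemma area_eqv: "eqv m u v \<Longrightarrow> null v \<Longrightarrow> area A R u \<le> m + area A R v"
  using eqv_trans[OF _ null_area_eqv, of m u v] by (simp add: eqv_def)

text \<open>The word \<open>[x, y] @ winv [y, x]\<close> is the commutator of two letters. It need
  not be a relator, but finitely many pairs give a uniform price for one adjacent swap.\<close>

definition comm_area :: nat where
  "comm_area = Max ((\<lambda>(x, y). area A R ([x, y] @ winv [y, x])) ` ((A \<times> UNIV) \<times> (A \<times> UNIV)))"

lemma eqv_swap: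
  assumes "fst x \<in> A" "fst y \<in> A"
  shows "eqv comm_area [x, y] [y, x]"
proof -
  have "null ([x, y] @ winv [y, x])"
    using null_commutator[of "[x]" "[y]"] assms by simp
  moreover have "area A R ([x, y] @ winv [y, x]) \<le> comm_area"
    unfolding comm_area_def using finite_A assms
    by (intro Max_ge) (auto intro!: image_eqI[of _ _ "(x, y)"] simp: mem_Times_iff)
  ultimately show ?thesis by (simp add: eqv_def)
qed

lemma eqv_move: "\<lbrakk>fst x \<in> A; u \<in> words A\<rbrakk> \<Longrightarrow> eqv (comm_area * length u) (x # u) (u @ [x])"
proof (induction u)
  case (Cons y u)
  have "eqv comm_area (x # y # u) (y # x # u)"
    using eqv_context[OF eqv_swap, of x y "[]" u] Cons.prems by simp
  moreover have "eqv (comm_area * length u) (y # x # u) (y # u @ [x])"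
    using eqv_context[OF Cons.IH, of "[y]" "[]"] Cons.prems by simp
  ultimately show ?case using eqv_trans by fastforce
qed (simp add: eqv_reduce)

text \<open>The new letter travels past the blocks preceding its own, one swap per letter, and joins
  its block by free reduction at no cost.\<close>

lemma eqv_Cons_exp_word:
  assumes "distinct xs" "set xs \<subseteq> A" "a \<in> set xs"
  shows "eqv (comm_area * length (exp_word xs v)) ((a, b) # exp_word xs v)
           (exp_word xs (\<lambda>c. letter_exp (a, b) c + v c))"
proof -
  obtain ys zs where xs: "xs = ys @ a # zs" using assms(3) by (meson split_list)
  let ?p = "exp_word ys v" and ?q = "exp_word zs v" and ?v = "\<lambda>c. letter_exp (a, b) c + v c"
  have w: "?p \<in> words A" "?q \<in> words A" "a \<in> A"
    using assms(2) unfolding xs by (auto simp: exp_word_in_words)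
  have eq: "exp_word ys ?v = ?p" "exp_word zs ?v = ?q"
    using assms(1) unfolding xs by (auto intro!: exp_word_cong simp: letter_exp_def)
  have "eqv (comm_area * length ?p) ([] @ ((a, b) # ?p) @ (wpow a (v a) @ ?q))
      ([] @ (?p @ [(a, b)]) @ (wpow a (v a) @ ?q))"
    using w by (intro eqv_context eqv_move) (auto simp: wpow_in_words)
  moreover have "eqv 0 (?p @ ((a, b) # wpow a (v a)) @ ?q) (?p @ wpow a (?v a) @ ?q)"
    using w by (intro eqv_context eqv_reduce)
      (auto simp: wpow_in_words reduce_Cons_wpow letter_exp_def add.commute)
  ultimately have "eqv (comm_area * length ?p + 0) ((a, b) # exp_word xs v) (exp_word xs ?v)"
    unfolding xs exp_word_simps eq by (intro eqv_trans) auto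
  then show ?thesis by (rule eqv_mono) (simp add: xs algebra_simps)
qed

definition gens :: "'a list" where
  "gens = (SOME xs. set xs = A \<and> distinct xs)"

lemma gens: "set gens = A" "distinct gens"
  using someI_ex[OF finite_distinct_list[OF finite_A]] by (simp_all add: gens_def)

text \<open>Insertion sort: the sorted word is never longer than the original, so each insertion has
  linear cost and the total is quadratic.\<close>

lemma eqv_exp_word: "w \<in> words A \<Longrightarrow> eqv (comm_area * length w ^ 2) w (exp_word gens (word_exp w))"
proof (induction w)
  case (Cons x w)
  let ?e = "exp_word gens (word_exp w)"
  have len: "length ?e \<le> length w"
    using length_exp_word[OF gens(2)] sum_abs_word_exp_le[OF finite_A, of w] gens(1)
    by (metis of_nat_le_iff)
  have "eqv (comm_area * length w ^ 2) (x # w) (x # ?e)"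
    using eqv_context[OF Cons.IH, of "[x]" "[]"] Cons.prems by simp
  moreover have "eqv (comm_area * length ?e) (x # ?e) (exp_word gens (word_exp (x # w)))"
    using eqv_Cons_exp_word[of gens "fst x" "word_exp w" "snd x"] gens Cons.prems
    unfolding word_exp_simps(2)[abs_def] by simp
  ultimately have "eqv (comm_area * length w ^ 2 + comm_area * length ?e)
      (x # w) (exp_word gens (word_exp (x # w)))" by (rule eqv_trans)
  moreover have "comm_area * length w ^ 2 + comm_area * length ?e \<le> comm_area * length (x # w) ^ 2"
  proof -
    have "comm_area * (length w ^ 2 + length ?e) \<le> comm_area * length (x # w) ^ 2"
      using len by (intro mult_le_mono2) (simp add: power2_eq_square)
    then show ?thesis by (simp only: distrib_left)
  qed
  ultimately show ?case by (rule eqv_mono)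
qed (simp add: eqv_reduce word_exp_simps(1)[abs_def])

text \<open>Both words sort to the same \<open>exp_word\<close>. This is the source of the quadratic
  area bounds below.\<close>

lemma eqv_word_exp:
  assumes "u \<in> words A" "v \<in> words A" "\<And>a. a \<in> A \<Longrightarrow> word_exp u a = word_exp v a"
  shows "eqv (comm_area * (length u ^ 2 + length v ^ 2)) u v"
proof -
  have "exp_word gens (word_exp u) = exp_word gens (word_exp v)"
    using assms(3) gens by (intro exp_word_cong) auto
  then show ?thesis
    using eqv_trans[OF eqv_exp_word[OF assms(1)], of "comm_area * length v ^ 2" v]
      eqv_sym[OF eqv_exp_word[OF assms(2)]]
    by (simp add: distrib_left)
qed

lemma null_word_exp:
  "\<lbrakk>null u; v \<in> words A; \<And>a. a \<in> A \<Longrightarrow> word_exp u a = word_exp v a\<rbrakk> \<Longrightarrow> null v"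
  using eqv_null[OF eqv_word_exp] null_in_words by blast

lemma null_wpower:
  assumes "null w"
  shows "null (wpower w k) \<and> area A R (wpower w k) \<le> nat \<bar>k\<bar> * area A R w"
proof -
  have *: "null (concat (replicate n u)) \<and> area A R (concat (replicate n u)) \<le> n * area A R u"
    if "null u" for n u
  proof (induction n)
    case (Suc n)
    then show ?case using null_append[OF that] area_append[OF that] by fastforce
  qed (simp add: null_Nil)
  show ?thesis
  proof (cases "k \<ge> 0")
    case False
    have "area A R (wpower w k) \<le> nat \<bar>k\<bar> * area A R (winv w)"
      using *[OF null_winv[OF assms], of "nat \<bar>k\<bar>"] False by (simp add: wpower_def)
    also have "\<dots> \<le> nat \<bar>k\<bar> * area A R w"
      using area_winv[OF assms] by simp
    finally show ?thesis
      using *[OF null_winv[OF assms], of "nat \<bar>k\<bar>"] False by (simp add: wpower_def)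
  qed (use *[OF assms] in \<open>simp add: wpower_def\<close>)
qed

end

section \<open>Normal forms of linear length\<close>

lemma sum_mult_le_mult_sum:
  fixes f g :: "'b \<Rightarrow> int"
  assumes "finite I" "\<And>i. i \<in> I \<Longrightarrow> 0 \<le> f i" "\<And>i. i \<in> I \<Longrightarrow> 0 \<le> g i"
  shows "(\<Sum>i\<in>I. f i * g i) \<le> (\<Sum>i\<in>I. f i) * (\<Sum>i\<in>I. g i)"
  unfolding sum_distrib_right
  using assms by (intro sum_mono mult_left_mono member_le_sum) auto

lemma abs_div_le:
  fixes v N :: int
  assumes "N > 0"
  shows "\<bar>v div N\<bar> \<le> \<bar>v\<bar>"
proof (cases "v \<ge> 0")
  case True
  then show ?thesis using assms zdiv_mono2[of v 1 N] by (simp add: pos_imp_zdiv_nonneg_iff)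
next
  case False
  have "v div N < 0" using False assms by (simp add: neg_imp_zdiv_neg_iff div_neg_pos_less0)
  moreover have "v div N \<ge> v" using False assms zdiv_mono2_neg[of v 1 N] by simp
  ultimately show ?thesis by simp
qed

lemma word_exp_concat_map:
  "distinct xs \<Longrightarrow> word_exp (concat (map f xs)) b = (\<Sum>a\<in>set xs. word_exp (f a) b)"
  by (induction xs) auto

lemma length_concat_map:
  "distinct xs \<Longrightarrow> length (concat (map f xs)) = (\<Sum>a\<in>set xs. length (f a))"
  by (induction xs) auto

section \<open>Homomorphisms to the integers\<close>

definition letter_weight :: "('a \<Rightarrow> int) \<Rightarrow> 'a letter \<Rightarrow> int" where
  "letter_weight c x = (if snd x then c (fst x) else - c (fst x))"

text \<open>The homomorphism from words to the integers with a |-> c a. It descends to the presented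
  group when it vanishes on null words.\<close>

definition weight :: "('a \<Rightarrow> int) \<Rightarrow> 'a letter list \<Rightarrow> int" where
  "weight c w = (\<Sum>x\<leftarrow>w. letter_weight c x)"

lemma weight_append [simp]: "weight c (u @ v) = weight c u + weight c v"
  by (simp add: weight_def)

lemma weight_word_exp:
  assumes "finite A" "w \<in> words A"
  shows "weight c w = (\<Sum>a\<in>A. word_exp w a * c a)"
  using assms(2)
proof (induction w)
  case (Cons x w)
  have "(\<Sum>a\<in>A. letter_exp x a * c a) = (\<Sum>a\<in>A. if fst x = a then letter_weight c x else 0)"
    by (intro sum.cong) (auto simp: letter_exp_def letter_weight_def)
  also have "\<dots> = letter_weight c x" using assms(1) Cons.prems by simp
  finally show ?case using Cons by (simp add: weight_def ring_distribs sum.distrib)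
qed (simp add: weight_def)

lemma weight_winv [simp]: "weight c (winv w) = - weight c w"
  by (induction w) (auto simp: weight_def letter_weight_def inv_letter_def)

context abelian_presentation
begin

lemma null_concat_map:
  assumes "distinct xs" "\<And>a. a \<in> set xs \<Longrightarrow> null (f a)"
  shows "null (concat (map f xs)) \<and> area A R (concat (map f xs)) \<le> (\<Sum>a\<in>set xs. area A R (f a))"
  using assms
proof (induction xs)
  case (Cons a xs)
  then have "null (f a)" "null (concat (map f xs))"
    "area A R (concat (map f xs)) \<le> (\<Sum>a\<in>set xs. area A R (f a))" by auto
  then show ?case using null_append area_append[of "f a" "concat (map f xs)"] Cons.prems by simp
qed (simp add: null_Nil)

text \<open>Linear independence over the integers of the image of \<open>S\<close> in the presented
  group: \<open>null (exp_word gens v)\<close> says that the combination with coefficients v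
  vanishes there.\<close>

definition independent :: "'a set \<Rightarrow> bool" where
  "independent S \<longleftrightarrow> (\<forall>v. (\<forall>a\<in>A - S. v a = 0) \<longrightarrow> null (exp_word gens v) \<longrightarrow> (\<forall>a\<in>A. v a = 0))"

text \<open>
  Here \<open>S\<close> is a maximal independent set of generators, and the null word \<open>\<rho> a\<close> is the relation
  N a = \<Sum>s\<in>S. c s a \<cdot> s of G. Independence then makes each \<open>c s\<close> extend to a homomorphism from G
  to the integers.
\<close>

lemma independent_weights:
  obtains S N \<rho> c where "S \<subseteq> A" "independent S" "N > 0"
    "\<forall>a\<in>A. null (\<rho> a)"
    "\<forall>a\<in>A. \<forall>b\<in>A. word_exp (\<rho> a) b = (if a = b then N else 0) - (if b \<in> S then c b a else 0)"
    "\<forall>s\<in>S. \<forall>t\<in>S. c s t = (if t = s then N else 0)"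
proof -
  let ?I = "{S. S \<subseteq> A \<and> independent S}"
  have "finite ?I" "{} \<in> ?I" using finite_A by (auto simp: independent_def)
  then obtain S where S: "S \<subseteq> A" "independent S" and max: "\<And>T. \<lbrakk>T \<subseteq> A; independent T; S \<subseteq> T\<rbrakk> \<Longrightarrow> T = S"
    using finite_has_maximal[OF \<open>finite ?I\<close>] by (metis (no_types, lifting) empty_iff mem_Collect_eq)
  \<comment> \<open>By maximality \<open>insert a S\<close> is dependent. Its relation must involve
    a, for otherwise S would be dependent; inverting the relation makes the coefficient of a
    positive.\<close>
  have "\<exists>v. null (exp_word gens v) \<and> (\<forall>b\<in>A - insert a S. v b = 0) \<and> v a > 0" if a: "a \<in> A - S" for a
  proof -
    have "\<not> independent (insert a S)" using max[of "insert a S"] a S by auto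
    then obtain v b where v: "null (exp_word gens v)" "\<forall>b\<in>A - insert a S. v b = 0" and b: "b \<in> A" "v b \<noteq> 0"
      unfolding independent_def by blast
    have va: "v a \<noteq> 0"
    proof
      assume "v a = 0"
      then have "\<forall>b\<in>A - S. v b = 0" using v(2) by auto
      then show False using S(2) v(1) b unfolding independent_def by blast
    qed
    show ?thesis
    proof (cases "v a > 0")
      case True
      then show ?thesis using v by blast
    next
      case False
      have "null (exp_word gens (\<lambda>b. - v b))"
        using null_word_exp[OF null_winv[OF v(1)]] gens
        by (simp add: exp_word_in_words word_exp_exp_word)
      then show ?thesis using False va v(2) by (intro exI[of _ "\<lambda>b. - v b"]) auto
    qed
  qed
  then obtain V where V: "\<And>a. a \<in> A - S \<Longrightarrow>
      null (exp_word gens (V a)) \<and> (\<forall>b\<in>A - insert a S. V a b = 0) \<and> V a a > 0" by metis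
  \<comment> \<open>A common multiple of the leading coefficients, so that all relations can be
    scaled to the same coefficient N.\<close>
  define N where "N = (\<Prod>a\<in>A - S. V a a)"
  have N: "N > 0" unfolding N_def using V by (intro prod_pos) blast
  have dvd: "N div V a a * V a a = N" if "a \<in> A - S" for a
    unfolding N_def using that finite_A by (intro dvd_div_mult_self dvd_prodI) auto
  \<comment> \<open>For a in S the relation is the trivial N a = N a: the empty word, with diagonal
    value N for \<open>c\<close>.\<close>
  define \<rho> where "\<rho> a = (if a \<in> S then [] else wpower (exp_word gens (V a)) (N div V a a))" for a
  define c where "c s a = (if a \<in> S then if a = s then N else 0 else - (N div V a a * V a s))" for s a
  show thesis
  proof (rule that[OF S N]; intro ballI)
    show "null (\<rho> a)" if "a \<in> A" for a
      using that V null_wpower unfolding \<rho>_def by (auto simp: null_Nil)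
    show "word_exp (\<rho> a) b = (if a = b then N else 0) - (if b \<in> S then c b a else 0)"
      if "a \<in> A" "b \<in> A" for a b
      using that V[of a] S(1) dvd[of a] unfolding \<rho>_def c_def by (auto simp: word_exp_exp_word gens)
    show "c s t = (if t = s then N else 0)" if "s \<in> S" "t \<in> S" for s t
      using that unfolding c_def by auto
  qed
qed

text \<open>What the weights cannot see, torsion included, lies in bounded remainders and is
  absorbed in \<open>C\<close>. The point is that the length of u is controlled by the weights of w
  rather than by the length of w.\<close>

lemma linear_normal_form:
  obtains S :: "'a set" and c C where "finite S"
    "\<forall>s\<in>S. \<forall>w. null w \<longrightarrow> weight (c s) w = 0"
    "\<forall>w\<in>words A. \<exists>u. eqv (C * (1 + length w)\<^sup>2) w u
       \<and> int (length u) \<le> int C + (\<Sum>s\<in>S. \<bar>weight (c s) w\<bar>)"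
proof -
  obtain S N c \<rho> where S: "S \<subseteq> A" "independent S" and N: "N > 0"
    and "\<forall>a\<in>A. null (\<rho> a)"
    and "\<forall>a\<in>A. \<forall>b\<in>A. word_exp (\<rho> a) b = (if a = b then N else 0) - (if b \<in> S then c b a else 0)"
    and "\<forall>s\<in>S. \<forall>t\<in>S. c s t = (if t = s then N else 0)"
    by (rule independent_weights)
  then have \<rho>_null: "\<And>a. a \<in> A \<Longrightarrow> null (\<rho> a)"
    and \<rho>_exp: "\<And>a b. \<lbrakk>a \<in> A; b \<in> A\<rbrakk> \<Longrightarrow>
       word_exp (\<rho> a) b = (if a = b then N else 0) - (if b \<in> S then c b a else 0)"
    and c: "\<And>s t. \<lbrakk>s \<in> S; t \<in> S\<rbrakk> \<Longrightarrow> c s t = (if t = s then N else 0)"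
    by auto
  have fS: "finite S" using S finite_A finite_subset by blast
  \<comment> \<open>Taking w to the power N and eliminating every generator outside S by the
    relations leaves a null word whose exponents on S are the weights of w and vanish elsewhere.
    Independence makes them zero.\<close>
  have weight_null: "weight (c s) w = 0" if s: "s \<in> S" and w: "null w" for s w
  proof -
    let ?W = "wpower w N @ concat (map (\<lambda>a. wpower (\<rho> a) (- word_exp w a)) gens)"
    let ?v = "\<lambda>b. if b \<in> S then weight (c b) w else 0"
    have W: "null ?W"
      using w \<rho>_null gens by (intro null_append conjunct1[OF null_wpower] conjunct1[OF null_concat_map]) auto
    have "word_exp ?W b = ?v b" if b: "b \<in> A" for b
    proof -
      have "word_exp ?W b = N * word_exp w b - (\<Sum>a\<in>A. word_exp w a * word_exp (\<rho> a) b)"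
        by (simp add: word_exp_concat_map gens sum_negf)
      also have "(\<Sum>a\<in>A. word_exp w a * word_exp (\<rho> a) b)
          = (\<Sum>a\<in>A. (if a = b then word_exp w a * N else 0) - (if b \<in> S then word_exp w a * c b a else 0))"
        by (intro sum.cong) (auto simp: \<rho>_exp b algebra_simps)
      also have "\<dots> = word_exp w b * N - ?v b"
        using b finite_A null_in_words[OF w] by (simp add: sum_subtractf weight_word_exp[of A])
      finally show ?thesis by simp
    qed
    then have "null (exp_word gens ?v)"
      by (intro null_word_exp[OF W]) (auto simp: exp_word_in_words word_exp_exp_word gens)
    moreover have "(\<forall>a\<in>A - S. ?v a = 0) \<longrightarrow> null (exp_word gens ?v) \<longrightarrow> (\<forall>a\<in>A. ?v a = 0)"
      using S(2) unfolding independent_def by (rule spec)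
    ultimately have "\<forall>a\<in>A. ?v a = 0" by simp
    then have "?v s = 0" using S(1) s by blast
    then show ?thesis using s by simp
  qed
  define L where "L = (\<Sum>a\<in>A. int (length (\<rho> a)))"
  define Ar where "Ar = (\<Sum>a\<in>A. int (area A R (\<rho> a)))"
  define Cc where "Cc = (\<Sum>s\<in>S. \<Sum>a\<in>A. \<bar>c s a\<bar>)"
  \<comment> \<open>\<open>E\<close> is the linear length constant of the intermediate word
    \<open>?W1 @ ?u\<close>. \<open>K\<close> adds the cost of sorting it and w to the area of the
    relations applied. \<open>C\<close> must also dominate the additive error in the length
    bound.\<close>
  define E where "E = L + Cc + int (card A) * N"
  define K where "K = int comm_area * (1 + E\<^sup>2) + Ar"
  define C where "C = nat (K + int (card A) * N + N * Cc)"
  have nonneg: "L \<ge> 0" "Ar \<ge> 0" "Cc \<ge> 0" "int (card A) * N \<ge> 0" "N * Cc \<ge> 0" "K \<ge> 0"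
    using N unfolding L_def Ar_def Cc_def K_def by (auto intro!: sum_nonneg add_nonneg_nonneg mult_nonneg_nonneg)
  have "\<exists>u. eqv (C * (1 + length w)\<^sup>2) w u \<and> int (length u) \<le> int C + (\<Sum>s\<in>S. \<bar>weight (c s) w\<bar>)"
    if w: "w \<in> words A" for w
  proof -
    let ?n = "int (length w)"
    \<comment> \<open>Dividing the exponents by N and applying the relations \<open>\<rho>\<close> to the quotients leaves bounded
      remainders and powers m s of the independent generators; the weights then bound m s.\<close>
    define q where "q a = word_exp w a div N" for a
    define r where "r a = word_exp w a mod N" for a
    define m where "m s = (\<Sum>a\<in>A. q a * c s a)" for s
    define u where "u b = r b + (if b \<in> S then m b else 0)" for b
    let ?W1 = "concat (map (\<lambda>a. wpower (\<rho> a) (q a)) gens)"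
    let ?u = "exp_word gens u"
    have qr: "word_exp w a = q a * N + r a" for a by (simp add: q_def r_def)
    have r: "\<bar>r a\<bar> \<le> N" for a using N by (simp add: r_def less_imp_le)
    have X: "(\<Sum>a\<in>A. \<bar>q a\<bar>) \<le> ?n"
      using sum_abs_word_exp_le[OF finite_A, of w] sum_mono[of A "\<lambda>a. \<bar>q a\<bar>" "\<lambda>a. \<bar>word_exp w a\<bar>"] abs_div_le[OF N]
      by (fastforce simp: q_def)
    have Xmult: "(\<Sum>a\<in>A. \<bar>q a\<bar> * g a) \<le> ?n * (\<Sum>a\<in>A. g a)" if "\<And>a. g a \<ge> 0" for g
    proof -
      have "(\<Sum>a\<in>A. \<bar>q a\<bar> * g a) \<le> (\<Sum>a\<in>A. \<bar>q a\<bar>) * (\<Sum>a\<in>A. g a)"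
        using finite_A that by (intro sum_mult_le_mult_sum) auto
      also have "\<dots> \<le> ?n * (\<Sum>a\<in>A. g a)"
        using X that by (intro mult_right_mono sum_nonneg) auto
      finally show ?thesis .
    qed
    have W1: "null ?W1" and area_W1: "int (area A R ?W1) \<le> ?n * Ar"
    proof -
      have nW: "null (wpower (\<rho> a) (q a)) \<and> int (area A R (wpower (\<rho> a) (q a))) \<le> \<bar>q a\<bar> * int (area A R (\<rho> a))"
        if "a \<in> A" for a
      proof -
        have "int (area A R (wpower (\<rho> a) (q a))) \<le> int (nat \<bar>q a\<bar> * area A R (\<rho> a))"
          using null_wpower[OF \<rho>_null[OF that]] by (simp only: of_nat_le_iff)
        then show ?thesis using null_wpower[OF \<rho>_null[OF that]] by simp
      qed
      have *: "null ?W1 \<and> area A R ?W1 \<le> (\<Sum>a\<in>set gens. area A R (wpower (\<rho> a) (q a)))"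
        using nW gens by (intro null_concat_map) auto
      then show "null ?W1" by blast
      have "int (area A R ?W1) \<le> (\<Sum>a\<in>A. int (area A R (wpower (\<rho> a) (q a))))"
        using * gens by (metis of_nat_le_iff of_nat_sum)
      also have "\<dots> \<le> (\<Sum>a\<in>A. \<bar>q a\<bar> * int (area A R (\<rho> a)))"
        using nW by (intro sum_mono) blast
      also have "\<dots> \<le> ?n * Ar" unfolding Ar_def by (rule Xmult) simp
      finally show "int (area A R ?W1) \<le> ?n * Ar" .
    qed
    have uw: "?u \<in> words A" by (simp add: exp_word_in_words gens)
    have len_W1: "int (length ?W1) \<le> ?n * L"
      using Xmult[of "\<lambda>a. int (length (\<rho> a))"] by (simp add: length_concat_map gens length_wpower L_def)
    have len_u: "int (length ?u) \<le> int (card A) * N + (\<Sum>s\<in>S. \<bar>m s\<bar>)"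
    proof -
      have "int (length ?u) = (\<Sum>a\<in>A. \<bar>u a\<bar>)" by (simp add: length_exp_word gens)
      also have "\<dots> \<le> (\<Sum>a\<in>A. N + (if a \<in> S then \<bar>m a\<bar> else 0))"
        using r by (intro sum_mono) (auto simp: u_def intro: order_trans[OF abs_triangle_ineq])
      also have "\<dots> = int (card A) * N + (\<Sum>s\<in>S. \<bar>m s\<bar>)"
        using finite_A S(1) by (simp add: sum.distrib sum.inter_restrict[symmetric] Int_absorb1)
      finally show ?thesis .
    qed
    have "(\<Sum>s\<in>S. \<bar>m s\<bar>) \<le> (\<Sum>s\<in>S. ?n * (\<Sum>a\<in>A. \<bar>c s a\<bar>))"
    proof (rule sum_mono)
      fix s
      have "\<bar>m s\<bar> \<le> (\<Sum>a\<in>A. \<bar>q a\<bar> * \<bar>c s a\<bar>)"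
        unfolding m_def by (rule order_trans[OF sum_abs]) (simp add: abs_mult)
      also have "\<dots> \<le> ?n * (\<Sum>a\<in>A. \<bar>c s a\<bar>)" by (rule Xmult) simp
      finally show "\<bar>m s\<bar> \<le> ?n * (\<Sum>a\<in>A. \<bar>c s a\<bar>)" .
    qed
    then have "(\<Sum>s\<in>S. \<bar>m s\<bar>) \<le> ?n * Cc" by (simp add: Cc_def sum_distrib_left)
    then have "int (length (?W1 @ ?u)) \<le> ?n * L + int (card A) * N + ?n * Cc"
      using len_W1 len_u by simp
    also have "\<dots> \<le> E * (1 + ?n)"
    proof -
      have "?n * (int (card A) * N) \<ge> 0" using N by (intro mult_nonneg_nonneg) auto
      then show ?thesis using nonneg N unfolding E_def by (simp add: algebra_simps)
    qed
    finally have len: "int (length (?W1 @ ?u)) \<le> E * (1 + ?n)" .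
    \<comment> \<open>The powers of \<rho> supply q b * N at b and subtract m b on S; the definition
      of u restores m b and adds the remainder.\<close>
    have exp: "word_exp w b = word_exp (?W1 @ ?u) b" if b: "b \<in> A" for b
    proof -
      have "word_exp (?W1 @ ?u) b = (\<Sum>a\<in>A. q a * word_exp (\<rho> a) b) + u b"
        using b by (simp add: word_exp_concat_map word_exp_exp_word gens)
      also have "(\<Sum>a\<in>A. q a * word_exp (\<rho> a) b)
          = (\<Sum>a\<in>A. (if a = b then q a * N else 0) - (if b \<in> S then q a * c b a else 0))"
        by (intro sum.cong) (auto simp: \<rho>_exp b algebra_simps)
      also have "\<dots> = q b * N - (if b \<in> S then m b else 0)"
        using b finite_A by (simp add: sum_subtractf m_def)
      finally show ?thesis using qr[of b] u_def[of b] by linarith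
    qed
    have "eqv (comm_area * (length w ^ 2 + length (?W1 @ ?u) ^ 2)) w (?W1 @ ?u)"
      using w W1 uw exp by (intro eqv_word_exp) (auto dest: null_in_words)
    moreover have "eqv (area A R ?W1) (?W1 @ ?u) ?u"
      using eqv_context[OF null_area_eqv[OF W1], of "[]" ?u] uw by simp
    ultimately have eqv1: "eqv (comm_area * (length w ^ 2 + length (?W1 @ ?u) ^ 2) + area A R ?W1) w ?u"
      by (rule eqv_trans)
    have cost: "comm_area * (length w ^ 2 + length (?W1 @ ?u) ^ 2) + area A R ?W1 \<le> C * (1 + length w)\<^sup>2"
    proof -
      have "int (length (?W1 @ ?u)) ^ 2 \<le> (E * (1 + ?n))\<^sup>2"
        using len by (intro power_mono) auto
      then have "int comm_area * (?n\<^sup>2 + int (length (?W1 @ ?u)) ^ 2) \<le> int comm_area * ((1 + ?n)\<^sup>2 + E\<^sup>2 * (1 + ?n)\<^sup>2)"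
        by (intro mult_left_mono add_mono power_mono) (auto simp: power_mult_distrib)
      moreover have "?n * Ar \<le> Ar * (1 + ?n)\<^sup>2"
        using nonneg mult_right_mono[of ?n "(1 + ?n)\<^sup>2" Ar] by (simp add: power2_eq_square algebra_simps)
      ultimately have "int comm_area * (?n\<^sup>2 + int (length (?W1 @ ?u)) ^ 2) + int (area A R ?W1) \<le> K * (1 + ?n)\<^sup>2"
        using area_W1 unfolding K_def by (simp add: algebra_simps)
      also have "\<dots> \<le> int C * (1 + ?n)\<^sup>2"
        using nonneg by (intro mult_right_mono) (auto simp: C_def)
      finally have "int (comm_area * (length w ^ 2 + length (?W1 @ ?u) ^ 2) + area A R ?W1) \<le> int (C * (1 + length w)\<^sup>2)"
        by simp
      then show ?thesis by (simp only: of_nat_le_iff)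
    qed
    \<comment> \<open>Weights are invariant under \<open>eqv\<close>, so they can be read off
      \<open>?u\<close>: there they are N * m s plus a contribution of the remainders that does not
      depend on w beyond a constant bound.\<close>
    have m_le: "\<bar>m s\<bar> \<le> \<bar>weight (c s) w\<bar> + N * (\<Sum>a\<in>A. \<bar>c s a\<bar>)" if s: "s \<in> S" for s
    proof -
      have "weight (c s) w = weight (c s) ?u"
        using weight_null[OF s, of "w @ winv ?u"] eqv1 by (simp add: eqv_def)
      also have "\<dots> = (\<Sum>a\<in>A. u a * c s a)"
        using uw by (simp add: weight_word_exp[OF finite_A] word_exp_exp_word gens)
      also have "\<dots> = (\<Sum>a\<in>A. r a * c s a + (if a \<in> S then m a * c s a else 0))"
        by (intro sum.cong) (auto simp: u_def algebra_simps)
      also have "\<dots> = (\<Sum>a\<in>A. r a * c s a) + (\<Sum>a\<in>S. m a * c s a)"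
        using finite_A S(1) by (simp add: sum.distrib sum.inter_restrict[symmetric] Int_absorb1)
      also have "(\<Sum>a\<in>S. m a * c s a) = (\<Sum>a\<in>S. if a = s then m a * N else 0)"
        using s c by (intro sum.cong) auto
      also have "\<dots> = m s * N" using s fS by simp
      finally have "m s * N = weight (c s) w - (\<Sum>a\<in>A. r a * c s a)" by simp
      moreover have "\<bar>\<Sum>a\<in>A. r a * c s a\<bar> \<le> N * (\<Sum>a\<in>A. \<bar>c s a\<bar>)"
        unfolding sum_distrib_left
        by (rule order_trans[OF sum_abs]) (auto intro!: sum_mono mult_right_mono r simp: abs_mult)
      moreover have "\<bar>m s\<bar> \<le> \<bar>m s * N\<bar>"
        using N mult_left_mono[of 1 N "\<bar>m s\<bar>"] by (simp add: abs_mult)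
      ultimately show ?thesis by linarith
    qed
    have "(\<Sum>s\<in>S. \<bar>m s\<bar>) \<le> (\<Sum>s\<in>S. \<bar>weight (c s) w\<bar> + N * (\<Sum>a\<in>A. \<bar>c s a\<bar>))"
      using m_le by (rule sum_mono)
    then have "int (length ?u) \<le> int C + (\<Sum>s\<in>S. \<bar>weight (c s) w\<bar>)"
      using len_u nonneg by (simp add: C_def Cc_def sum.distrib sum_distrib_left)
    then show ?thesis using eqv_mono[OF eqv1 cost] by blast
  qed
  then show thesis using fS weight_null by (intro that[of S c C] ballI allI impI)
qed

lemma finite_words_bounded: "finite {w \<in> words A. length w \<le> n}"
  using finite_lists_length_le[of "A \<times> (UNIV :: bool set)" n] finite_A
  by (rule_tac finite_subset) (auto simp: words_def)

end

section \<open>Exchangeable letters\<close>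

lemma sum_squared_le_card_mult:
  fixes f :: "'b \<Rightarrow> int"
  shows "(\<Sum>i\<in>I. f i)\<^sup>2 \<le> int (card I) * (\<Sum>i\<in>I. (f i)\<^sup>2)"
proof -
  have "(\<Sum>i\<in>I. f i)\<^sup>2 = (\<Sum>i\<in>I. \<Sum>j\<in>I. f i * f j)"
    by (simp only: power2_eq_square sum_product)
  then have "2 * (\<Sum>i\<in>I. f i)\<^sup>2 = (\<Sum>i\<in>I. \<Sum>j\<in>I. 2 * f i * f j)"
    by (simp add: sum_distrib_left mult.assoc)
  also have "\<dots> \<le> (\<Sum>i\<in>I. \<Sum>j\<in>I. (f i)\<^sup>2 + (f j)\<^sup>2)"
  proof (intro sum_mono)
    fix i j
    show "2 * f i * f j \<le> (f i)\<^sup>2 + (f j)\<^sup>2"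
      using zero_le_power2[of "f i - f j"] by (simp add: power2_diff)
  qed
  also have "\<dots> = 2 * (int (card I) * (\<Sum>i\<in>I. (f i)\<^sup>2))"
    by (simp add: sum.distrib sum_distrib_left)
  finally show ?thesis by simp
qed

text \<open>In the correlation matrix \<open>E\<close> each row sums to zero and has equal
  off-diagonal entries. Its diagonal entry is nonnegative, so the others are nonpositive, and the
  second moment is at most the diagonal part.\<close>

lemma exchangeable_second_moment_le:
  fixes f :: "'b \<Rightarrow> int"
  assumes len: "\<And>w. w \<in> S \<Longrightarrow> length w = n"
    and swap: "\<And>w i j. \<lbrakk>w \<in> S; i < n; j < n\<rbrakk> \<Longrightarrow> w[i := w ! j, j := w ! i] \<in> S"
    and zero: "\<And>w. w \<in> S \<Longrightarrow> (\<Sum>x\<leftarrow>w. f x) = 0"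
    and bound: "\<And>w x. \<lbrakk>w \<in> S; x \<in> set w\<rbrakk> \<Longrightarrow> \<bar>f x\<bar> \<le> M"
    and I: "I \<subseteq> {..<n}"
  shows "(\<Sum>w\<in>S. (\<Sum>i\<in>I. f (w ! i))\<^sup>2) \<le> int (card I) * (M\<^sup>2 * int (card S))"
proof -
  define E where "E i j = (\<Sum>w\<in>S. f (w ! i) * f (w ! j))" for i j
  have fI: "finite I" using I finite_subset by blast
  \<comment> \<open>Exchanging positions j and k is an involution of S that leaves position i
    alone.\<close>
  have E_swap: "E i j = E i k" if "i < n" "j < n" "k < n" "i \<noteq> j" "i \<noteq> k" for i j k
    unfolding E_def using that len swap
    by (intro sum.reindex_bij_witness[where i = "\<lambda>w. w[j := w ! k, k := w ! j]"
          and j = "\<lambda>w. w[j := w ! k, k := w ! j]"])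
      (auto simp: nth_list_update list_eq_iff_nth_eq)
  have E_nonneg: "E i i \<ge> 0" for i unfolding E_def by (intro sum_nonneg) simp
  have E_nonpos: "E i j \<le> 0" if ij: "i < n" "j < n" "i \<noteq> j" for i j
  proof -
    have "(\<Sum>k<n. E i k) = (\<Sum>w\<in>S. f (w ! i) * (\<Sum>k<n. f (w ! k)))"
      unfolding E_def sum_distrib_left by (rule sum.swap)
    also have "\<dots> = 0"
      using zero len by (intro sum.neutral) (simp add: sum_list_sum_nth atLeast0LessThan)
    finally have "E i i + (\<Sum>k\<in>{..<n} - {i}. E i k) = 0"
      using ij by (simp add: sum.remove[of "{..<n}" i "E i"])
    also have "(\<Sum>k\<in>{..<n} - {i}. E i k) = (\<Sum>k\<in>{..<n} - {i}. E i j)"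
      using ij by (intro sum.cong refl E_swap) auto
    also have "(\<Sum>k\<in>{..<n} - {i}. E i j) = int (n - 1) * E i j" using ij by simp
    finally have "int (n - 1) * E i j \<le> 0" using E_nonneg[of i] by linarith
    moreover have "int (n - 1) > 0" using ij by linarith
    ultimately show ?thesis by (simp add: mult_le_0_iff)
  qed
  have E_diag: "E i i \<le> M\<^sup>2 * int (card S)" if "i < n" for i
  proof -
    have "E i i \<le> (\<Sum>w\<in>S. M\<^sup>2)"
      unfolding E_def
    proof (rule sum_mono)
      fix w assume "w \<in> S"
      then have "\<bar>f (w ! i)\<bar> \<le> \<bar>M\<bar>" using bound[of w "w ! i"] len[of w] that by force
      then show "f (w ! i) * f (w ! i) \<le> M\<^sup>2" by (simp add: abs_le_square_iff power2_eq_square)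
    qed
    then show ?thesis by (simp add: mult.commute)
  qed
  have "(\<Sum>w\<in>S. (\<Sum>i\<in>I. f (w ! i))\<^sup>2) = (\<Sum>w\<in>S. \<Sum>i\<in>I. \<Sum>j\<in>I. f (w ! i) * f (w ! j))"
    by (simp add: power2_eq_square sum_product)
  also have "\<dots> = (\<Sum>i\<in>I. \<Sum>w\<in>S. \<Sum>j\<in>I. f (w ! i) * f (w ! j))"
    by (rule sum.swap)
  also have "\<dots> = (\<Sum>i\<in>I. \<Sum>j\<in>I. E i j)"
    unfolding E_def by (intro sum.cong refl sum.swap)
  also have "\<dots> \<le> (\<Sum>i\<in>I. M\<^sup>2 * int (card S))"
  proof (rule sum_mono)
    fix i assume i: "i \<in> I"
    have "(\<Sum>j\<in>I. E i j) = E i i + (\<Sum>j\<in>I - {i}. E i j)" using i fI by (intro sum.remove)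
    also have "(\<Sum>j\<in>I - {i}. E i j) \<le> 0" using i I by (intro sum_nonpos E_nonpos) auto
    finally show "(\<Sum>j\<in>I. E i j) \<le> M\<^sup>2 * int (card S)" using E_diag[of i] i I by fastforce
  qed
  finally show ?thesis by (simp add: mult.assoc)
qed

lemma weight_take_drop:
  "i + m \<le> length w \<Longrightarrow> weight c (take m (drop i w)) = (\<Sum>j\<in>{i..<i + m}. letter_weight c (w ! j))"
  using sum.shift_bounds_nat_ivl[of "\<lambda>j. letter_weight c (w ! j)" 0 i m]
  by (simp add: weight_def sum_list_sum_nth add.commute)

context abelian_presentation
begin

lemma null_sphere_eq: "null_sphere A R n = {w. null w \<and> length w = n}"
  by (auto simp: null_sphere_def null_def)

text \<open>Exponent sums depend only on the multiset of letters, and they determine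
  nullity.\<close>

lemma null_sphere_swap:
  assumes w: "w \<in> null_sphere A R n" and ij: "i < n" "j < n"
  shows "w[i := w ! j, j := w ! i] \<in> null_sphere A R n"
proof -
  let ?v = "w[i := w ! j, j := w ! i]"
  have nw: "null w" "length w = n" using w by (auto simp: null_sphere_eq)
  have m: "mset ?v = mset w" using nw ij by (intro mset_swap) auto
  have "word_exp ?v a = word_exp w a" for a
    unfolding word_exp_def sum_mset_sum_list[symmetric] mset_map m ..
  moreover have "?v \<in> words A"
    using null_in_words[OF nw(1)] m by (metis in_words_iff set_mset_mset)
  ultimately have "null ?v" using null_word_exp[OF nw(1)] by simp
  then show ?thesis using nw by (simp add: null_sphere_eq)
qed

lemma second_moment_weight_segment:
  assumes "\<And>w. null w \<Longrightarrow> weight c w = 0" "i + m \<le> n"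
  shows "(\<Sum>w\<in>null_sphere A R n. (weight c (take m (drop i w)))\<^sup>2)
    \<le> int m * ((\<Sum>a\<in>A. \<bar>c a\<bar>)\<^sup>2 * int (card (null_sphere A R n)))"
proof -
  have "(\<Sum>w\<in>null_sphere A R n. (weight c (take m (drop i w)))\<^sup>2)
      = (\<Sum>w\<in>null_sphere A R n. (\<Sum>j\<in>{i..<i + m}. letter_weight c (w ! j))\<^sup>2)"
    using assms(2) by (intro sum.cong) (auto simp: null_sphere_eq weight_take_drop)
  also have "\<dots> \<le> int (card {i..<i + m}) * ((\<Sum>a\<in>A. \<bar>c a\<bar>)\<^sup>2 * int (card (null_sphere A R n)))"
  proof (rule exchangeable_second_moment_le)
    fix w x assume "w \<in> null_sphere A R n" "x \<in> set w"
    then have "fst x \<in> A" by (auto simp: null_sphere_def in_words_iff)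
    then have "\<bar>c (fst x)\<bar> \<le> (\<Sum>a\<in>A. \<bar>c a\<bar>)" using finite_A by (intro member_le_sum) auto
    then show "\<bar>letter_weight c x\<bar> \<le> (\<Sum>a\<in>A. \<bar>c a\<bar>)" by (simp add: letter_weight_def)
  qed (use assms null_sphere_swap in \<open>auto simp: null_sphere_eq weight_def\<close>)
  finally show ?thesis by simp
qed

end

section \<open>Dyadic merging\<close>

context abelian_presentation
begin

text \<open>If f(k) bounds the mean cost at scale 2^k, merging gives f(k+1) <= 2 f(k) + O(2^(k+1)),
  solved by a multiple of (k+1) 2^k. Admitting every n up to 2^k lets one k serve all radii of a
  ball.\<close>

lemma sum_area_null_sphere_le:
  "\<exists>D::int. \<forall>n k. n \<le> 2 ^ k \<longrightarrow>
     (\<Sum>w\<in>null_sphere A R n. int (area A R w)) \<le> D * (int k + 1) * 2 ^ k * int (card (null_sphere A R n))"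
proof -
  obtain S :: "'a set" and c C where fS: "finite S"
    and weight_null: "\<forall>s\<in>S. \<forall>w. null w \<longrightarrow> weight (c s) w = 0"
    and "\<forall>w\<in>words A. \<exists>u. eqv (C * (1 + length w)\<^sup>2) w u
       \<and> int (length u) \<le> int C + (\<Sum>s\<in>S. \<bar>weight (c s) w\<bar>)"
    by (rule linear_normal_form)
  then obtain nf where
    nf: "\<And>w. w \<in> words A \<Longrightarrow> eqv (C * (1 + length w)\<^sup>2) w (nf w)
       \<and> int (length (nf w)) \<le> int C + (\<Sum>s\<in>S. \<bar>weight (c s) w\<bar>)" by metis
  \<comment> \<open>\<open>X\<close> controls the length of normal forms. Its square is dominated,
    by Cauchy-Schwarz, by a multiple of \<open>\<Phi>\<close>, whose mean over a sphere is
    available.\<close>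
  define X where "X w = (\<Sum>s\<in>S. \<bar>weight (c s) w\<bar>)" for w
  define \<Phi> where "\<Phi> w = (\<Sum>s\<in>S. (weight (c s) w)\<^sup>2)" for w
  have nf_eqv: "eqv (C * (1 + length w)\<^sup>2) w (nf w)" and nf_len: "int (length (nf w)) \<le> int C + X w"
    if "w \<in> words A" for w using nf[OF that] unfolding X_def by auto
  have X_null: "X w = 0" if "null w" for w using that weight_null by (simp add: X_def)
  have X_append: "X (u @ v) \<le> X u + X v" for u v
    unfolding X_def sum.distrib[symmetric] by (intro sum_mono) (simp add: abs_triangle_ineq)
  have \<Phi>_nonneg: "\<Phi> w \<ge> 0" for w by (simp add: \<Phi>_def sum_nonneg)
  have X_sq: "(X w)\<^sup>2 \<le> int (card S) * \<Phi> w" for w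
    using sum_squared_le_card_mult[of "\<lambda>s. \<bar>weight (c s) w\<bar>" S] by (simp add: X_def \<Phi>_def)
  \<comment> \<open>Quadratic Dehn bound: a null word has zero weights, so its normal form has
    length at most C, and finitely many such words have bounded area.\<close>
  obtain Q :: int where Q: "Q \<ge> 0" "\<And>w. null w \<Longrightarrow> int (area A R w) \<le> Q * (1 + int (length w))\<^sup>2"
  proof
    let ?M = "\<Sum>w\<in>{w \<in> words A. length w \<le> C}. area A R w"
    fix w assume w: "null w"
    have eq: "eqv (C * (1 + length w)\<^sup>2) w (nf w)" using nf_eqv w null_in_words by blast
    then have n: "null (nf w)" using eqv_null w by blast
    have "length (nf w) \<le> C" using nf_len[of w] X_null[OF w] w null_in_words by simp
    then have "area A R (nf w) \<le> ?M"
      using finite_words_bounded[of C] null_in_words[OF n] by (intro member_le_sum) auto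
    then have "area A R w \<le> C * (1 + length w)\<^sup>2 + ?M" using area_eqv[OF eq n] by linarith
    also have "\<dots> \<le> (C + ?M) * (1 + length w)\<^sup>2" by (simp add: distrib_right)
    finally have "int (area A R w) \<le> int ((C + ?M) * (1 + length w)\<^sup>2)" by (simp only: of_nat_le_iff)
    then show "int (area A R w) \<le> int (C + ?M) * (1 + int (length w))\<^sup>2" by simp
  qed (simp add: sum_nonneg)
  define T where "T w = int (area A R (w @ winv (nf w)))" for w
  have T_eqv: "eqv (nat (T w)) w (nf w)" if "w \<in> words A" for w
    using nf_eqv[OF that] by (simp add: eqv_def T_def)
  have T_nonneg: "T w \<ge> 0" for w by (simp add: T_def)
  \<comment> \<open>The three normal forms meeting at a merge have total length at most 3 C + 2 X u
    + 2 X v. Squaring a sum of three terms gives the factor 3, and 12 is 3 times the square of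
    2.\<close>
  define P where "P = Q * (3 * (1 + 3 * int C)\<^sup>2 + 12 * int (card S))"
  have P_nonneg: "P \<ge> 0" using Q(1) by (simp add: P_def)
  have T_append: "T (u @ v) \<le> T u + T v + P * (1 + \<Phi> u + \<Phi> v)"
    if u: "u \<in> words A" and v: "v \<in> words A" for u v
  proof -
    let ?z = "(nf u @ nf v) @ winv (nf (u @ v))"
    have uv: "u @ v \<in> words A" using u v by simp
    have nw: "nf u \<in> words A" "nf v \<in> words A" using T_eqv[OF u] T_eqv[OF v] eqv_in_words by auto
    have "eqv (nat (T u)) (u @ v) (nf u @ v)"
      using eqv_context[OF T_eqv[OF u], of "[]" v] v by simp
    moreover have "eqv (nat (T v)) (nf u @ v) (nf u @ nf v)"
      using eqv_context[OF T_eqv[OF v], of "nf u" "[]"] nw by simp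
    ultimately have 1: "eqv (nat (T u) + nat (T v)) (u @ v) (nf u @ nf v)" by (rule eqv_trans)
    have z: "null ?z"
      using eqv_trans[OF eqv_sym[OF 1] T_eqv[OF uv]] by (simp add: eqv_def)
    then have "eqv (area A R ?z) (nf u @ nf v) (nf (u @ v))" by (simp add: eqv_def)
    with 1 have "eqv (nat (T u) + nat (T v) + area A R ?z) (u @ v) (nf (u @ v))" by (rule eqv_trans)
    then have le: "T (u @ v) \<le> T u + T v + int (area A R ?z)"
      using T_nonneg[of u] T_nonneg[of v] unfolding eqv_def T_def by linarith
    have "int (length ?z) \<le> 3 * int C + 2 * X u + 2 * X v"
      using nf_len[OF u] nf_len[OF v] nf_len[OF uv] X_append[of u v] by simp
    then have "(1 + int (length ?z))\<^sup>2 \<le> ((1 + 3 * int C) + 2 * X u + 2 * X v)\<^sup>2"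
      by (intro power_mono) auto
    also have "\<dots> \<le> 3 * ((1 + 3 * int C)\<^sup>2 + (2 * X u)\<^sup>2 + (2 * X v)\<^sup>2)"
    proof -
      have "(a + b + d)\<^sup>2 \<le> 3 * (a\<^sup>2 + b\<^sup>2 + d\<^sup>2)" for a b d :: int
        using zero_le_power2[of "a - b"] zero_le_power2[of "a - d"] zero_le_power2[of "b - d"]
        by (simp add: power2_eq_square algebra_simps)
      then show ?thesis .
    qed
    also have "\<dots> \<le> 3 * (1 + 3 * int C)\<^sup>2 + 12 * int (card S) * (\<Phi> u + \<Phi> v)"
      using X_sq[of u] X_sq[of v] by (simp add: power_mult_distrib distrib_left)
    also have "\<dots> \<le> (3 * (1 + 3 * int C)\<^sup>2 + 12 * int (card S)) * (1 + \<Phi> u + \<Phi> v)"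
    proof -
      have "0 \<le> (3 * (1 + 3 * int C)\<^sup>2) * (\<Phi> u + \<Phi> v)" using \<Phi>_nonneg by simp
      then show ?thesis by (simp add: distrib_left distrib_right)
    qed
    finally have "(1 + int (length ?z))\<^sup>2
        \<le> (3 * (1 + 3 * int C)\<^sup>2 + 12 * int (card S)) * (1 + \<Phi> u + \<Phi> v)" .
    then have "Q * (1 + int (length ?z))\<^sup>2
        \<le> Q * ((3 * (1 + 3 * int C)\<^sup>2 + 12 * int (card S)) * (1 + \<Phi> u + \<Phi> v))"
      using Q(1) by (rule mult_left_mono)
    then have "int (area A R ?z) \<le> P * (1 + \<Phi> u + \<Phi> v)"
      using Q(2)[OF z] unfolding P_def by (simp only: mult.assoc)
    then show ?thesis using le by linarith
  qed
  define B where "B = (\<Sum>s\<in>S. (\<Sum>a\<in>A. \<bar>c s a\<bar>)\<^sup>2)"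
  have B_nonneg: "B \<ge> 0" by (simp add: B_def sum_nonneg)
  have \<Phi>_segment: "(\<Sum>w\<in>null_sphere A R n. \<Phi> (take m (drop i w))) \<le> int m * (B * int (card (null_sphere A R n)))"
    if "i + m \<le> n" for i m n
  proof -
    have "(\<Sum>w\<in>null_sphere A R n. \<Phi> (take m (drop i w)))
        = (\<Sum>s\<in>S. \<Sum>w\<in>null_sphere A R n. (weight (c s) (take m (drop i w)))\<^sup>2)"
      unfolding \<Phi>_def by (rule sum.swap)
    also have "\<dots> \<le> (\<Sum>s\<in>S. int m * ((\<Sum>a\<in>A. \<bar>c s a\<bar>)\<^sup>2 * int (card (null_sphere A R n))))"
      using weight_null that by (intro sum_mono second_moment_weight_segment) auto
    also have "\<dots> = int m * (B * int (card (null_sphere A R n)))"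
      by (simp add: B_def sum_distrib_left sum_distrib_right)
    finally show ?thesis .
  qed
  \<comment> \<open>\<open>P * (1 + B)\<close> pays for one level of merging per unit of length;
    \<open>4 * int C\<close> pays for a segment of at most one letter, where
    \<open>(1 + length w)^2\<close> is at most 4.\<close>
  define D where "D = P * (1 + B) + 4 * int C"
  have D: "D \<ge> 0" "4 * int C \<le> D" "P * (1 + B) \<le> D"
    using P_nonneg B_nonneg by (simp_all add: D_def)
  have T_segment: "(\<Sum>w\<in>null_sphere A R n. T (take m (drop i w)))
      \<le> D * (int k + 1) * 2 ^ k * int (card (null_sphere A R n))"
    if "m \<le> 2 ^ k" "i + m \<le> n" for n m i k
    using that
  proof (induction k arbitrary: m i)
    case 0
    have "(\<Sum>w\<in>null_sphere A R n. T (take m (drop i w))) \<le> (\<Sum>w\<in>null_sphere A R n. D)"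
    proof (rule sum_mono)
      fix w assume "w \<in> null_sphere A R n"
      then have "w \<in> words A" by (simp add: null_sphere_def)
      then have "take m (drop i w) \<in> words A" by (auto simp: in_words_iff dest: in_set_takeD in_set_dropD)
      from nf_eqv[OF this]
      have "T (take m (drop i w)) \<le> int (C * (1 + length (take m (drop i w)))\<^sup>2)"
        unfolding T_def eqv_def by (simp only: of_nat_le_iff)
      also have "\<dots> \<le> int (C * (1 + 1)\<^sup>2)"
        unfolding of_nat_le_iff using 0 by (intro mult_le_mono2 power_mono) auto
      finally show "T (take m (drop i w)) \<le> D" using D(2) by (simp add: mult.commute)
    qed
    then show ?case by (simp add: mult.commute)
  next
    case (Suc k)
    \<comment> \<open>Rounded halves of any m up to 2^(k+1) have length at most 2^k, so n need not
      be a power of two.\<close>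
    let ?N = "null_sphere A R n" and ?l = "m div 2" and ?r = "m - m div 2"
    let ?c = "int (card ?N)"
    have lr: "?l \<le> 2 ^ k" "?r \<le> 2 ^ k" "i + ?l \<le> n" "(i + ?l) + ?r \<le> n" using Suc.prems by auto
    have "(\<Sum>w\<in>?N. T (take m (drop i w)))
        \<le> (\<Sum>w\<in>?N. T (take ?l (drop i w)) + T (take ?r (drop (i + ?l) w))
             + P * (1 + \<Phi> (take ?l (drop i w)) + \<Phi> (take ?r (drop (i + ?l) w))))"
    proof (rule sum_mono)
      fix w assume "w \<in> ?N"
      then have w: "w \<in> words A" by (simp add: null_sphere_def)
      have sub: "take p (drop q w) \<in> words A" for p q
        using w by (auto simp: in_words_iff dest: in_set_takeD in_set_dropD)
      have "take m (drop i w) = take ?l (drop i w) @ take ?r (drop (i + ?l) w)"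
        using take_add[of ?l ?r "drop i w"] by (simp add: add.commute)
      then show "T (take m (drop i w)) \<le> T (take ?l (drop i w)) + T (take ?r (drop (i + ?l) w))
             + P * (1 + \<Phi> (take ?l (drop i w)) + \<Phi> (take ?r (drop (i + ?l) w)))"
        using T_append[OF sub sub] by simp
    qed
    also have "\<dots> = (\<Sum>w\<in>?N. T (take ?l (drop i w))) + (\<Sum>w\<in>?N. T (take ?r (drop (i + ?l) w)))
             + P * (?c + (\<Sum>w\<in>?N. \<Phi> (take ?l (drop i w))) + (\<Sum>w\<in>?N. \<Phi> (take ?r (drop (i + ?l) w))))"
      by (simp add: sum.distrib sum_distrib_left distrib_left)
    also have "\<dots> \<le> D * (int k + 1) * 2 ^ k * ?c + D * (int k + 1) * 2 ^ k * ?c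
             + P * (?c + int ?l * (B * ?c) + int ?r * (B * ?c))"
      using Suc.IH[OF lr(1,3)] Suc.IH[OF lr(2,4)] \<Phi>_segment[OF lr(3)] \<Phi>_segment[OF lr(4)] P_nonneg
      by (intro add_mono mult_left_mono order_refl)
    \<comment> \<open>Even a merge of short segments has the fixed cost P; it is charged to the
      scale 2^(k+1).\<close>
    also have "P * (?c + int ?l * (B * ?c) + int ?r * (B * ?c)) \<le> P * (2 ^ Suc k * ?c + 2 ^ Suc k * (B * ?c))"
    proof (intro mult_left_mono P_nonneg)
      have "int ?l * (B * ?c) + int ?r * (B * ?c) = int (?l + ?r) * (B * ?c)"
        by (simp only: of_nat_add distrib_right)
      also have "\<dots> \<le> 2 ^ Suc k * (B * ?c)"
      proof (rule mult_right_mono)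
        have "int (?l + ?r) \<le> int (2 ^ Suc k)" unfolding of_nat_le_iff using Suc.prems(1) by simp
        then show "int (?l + ?r) \<le> 2 ^ Suc k" by simp
      qed (simp add: B_nonneg)
      finally show "?c + int ?l * (B * ?c) + int ?r * (B * ?c) \<le> 2 ^ Suc k * ?c + 2 ^ Suc k * (B * ?c)"
        using mult_right_mono[OF one_le_power[of "2 :: int" "Suc k"], of ?c] by simp
    qed
    also have "P * (2 ^ Suc k * ?c + 2 ^ Suc k * (B * ?c)) = P * (1 + B) * (2 ^ Suc k * ?c)"
      by (simp add: algebra_simps)
    also have "\<dots> \<le> D * (2 ^ Suc k * ?c)" using D(3) by (intro mult_right_mono) auto
    finally have "(\<Sum>w\<in>?N. T (take m (drop i w)))
        \<le> D * (int k + 1) * 2 ^ k * ?c + D * (int k + 1) * 2 ^ k * ?c + D * (2 ^ Suc k * ?c)" by simp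
    also have "\<dots> = D * (int (Suc k) + 1) * 2 ^ Suc k * ?c" by (simp add: algebra_simps)
    finally show ?case .
  qed
  \<comment> \<open>The area of the bounded normal form that remains after a null word has been
    rewritten.\<close>
  define D' where "D' = Q * (1 + int C)\<^sup>2"
  have D': "D' \<ge> 0" using Q(1) by (simp add: D'_def)
  have area_T: "int (area A R w) \<le> T w + D'" if w: "null w" for w
  proof -
    note ww = null_in_words[OF w]
    have n: "null (nf w)" using T_eqv[OF ww] eqv_null w by blast
    have "int (length (nf w)) \<le> int C" using nf_len[OF ww] X_null[OF w] by simp
    then have "Q * (1 + int (length (nf w)))\<^sup>2 \<le> D'"
      unfolding D'_def using Q(1) by (intro mult_left_mono power_mono) auto
    then show ?thesis using Q(2)[OF n] area_eqv[OF T_eqv[OF ww] n] T_nonneg[of w] by linarith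
  qed
  show ?thesis
  proof (intro exI[of _ "D + D'"] allI impI)
    fix n k :: nat assume nk: "n \<le> 2 ^ k"
    let ?N = "null_sphere A R n"
    have "(\<Sum>w\<in>?N. int (area A R w)) \<le> (\<Sum>w\<in>?N. T (take n (drop 0 w)) + D')"
      using area_T by (intro sum_mono) (auto simp: null_sphere_eq)
    also have "\<dots> = (\<Sum>w\<in>?N. T (take n (drop 0 w))) + D' * int (card ?N)"
      by (simp add: sum.distrib mult.commute)
    also have "\<dots> \<le> D * (int k + 1) * 2 ^ k * int (card ?N) + D' * ((int k + 1) * 2 ^ k) * int (card ?N)"
    proof (rule add_mono)
      show "(\<Sum>w\<in>?N. T (take n (drop 0 w))) \<le> D * (int k + 1) * 2 ^ k * int (card ?N)"
        using nk by (intro T_segment) auto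
      have "1 * 1 \<le> (int k + 1) * 2 ^ k" by (intro mult_mono) auto
      then show "D' * int (card ?N) \<le> D' * ((int k + 1) * 2 ^ k) * int (card ?N)"
        using D' mult_left_mono[of 1 "(int k + 1) * 2 ^ k" D'] by (intro mult_right_mono) auto
    qed
    also have "\<dots> = (D + D') * (int k + 1) * 2 ^ k * int (card ?N)" by (simp add: algebra_simps)
    finally show "(\<Sum>w\<in>?N. int (area A R w)) \<le> (D + D') * (int k + 1) * 2 ^ k * int (card ?N)" .
  qed
qed

section \<open>From spheres to balls\<close>

lemma null_ball_decomp:
  "(\<Sum>w\<in>null_ball A R n. g w) = (\<Sum>j\<le>n. \<Sum>w\<in>null_sphere A R j. g w)" for g :: "'a letter list \<Rightarrow> int"
proof -
  have "finite (null_ball A R n)"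
    using finite_words_bounded[of n] by (rule finite_subset[rotated]) (auto simp: null_ball_def)
  then have "(\<Sum>w\<in>null_ball A R n. g w) = (\<Sum>j\<le>n. \<Sum>w\<in>{w \<in> null_ball A R n. length w = j}. g w)"
    by (intro sum.group[symmetric]) (auto simp: null_ball_def)
  also have "\<dots> = (\<Sum>j\<le>n. \<Sum>w\<in>null_sphere A R j. g w)"
    by (intro sum.cong) (auto simp: null_ball_def null_sphere_def)
  finally show ?thesis .
qed

text \<open>One factor serves all radii up to n and multiplies the cardinality, so the bound adds up
  over the disjoint spheres.\<close>

lemma sum_area_null_ball_le:
  assumes D: "\<forall>n k. n \<le> 2 ^ k \<longrightarrow>
     (\<Sum>w\<in>null_sphere A R n. int (area A R w)) \<le> D * (int k + 1) * 2 ^ k * int (card (null_sphere A R n))"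
    and n: "n \<le> 2 ^ k"
  shows "(\<Sum>w\<in>null_ball A R n. int (area A R w)) \<le> D * (int k + 1) * 2 ^ k * int (card (null_ball A R n))"
proof -
  have "(\<Sum>w\<in>null_ball A R n. int (area A R w))
      \<le> (\<Sum>j\<le>n. D * (int k + 1) * 2 ^ k * (\<Sum>w\<in>null_sphere A R j. 1))"
    unfolding null_ball_decomp using D n by (intro sum_mono) auto
  also have "\<dots> = D * (int k + 1) * 2 ^ k * (\<Sum>w\<in>null_ball A R n. 1)"
    unfolding null_ball_decomp sum_distrib_left ..
  finally show ?thesis by simp
qed

end

section \<open>From dyadic scales to logarithms\<close>

lemma dyadic_scale_le:
  fixes D :: real
  assumes "n \<ge> 2" "D \<ge> 0"
  obtains k where "n \<le> 2 ^ k" "D * (real k + 1) * 2 ^ k \<le> 6 * D / (ln 2)\<^sup>2 * real n * (ln (real n))\<^sup>2"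
proof -
  obtain k where k: "2 ^ k \<le> n" "n < 2 ^ (k + 1)" using ex_power_ivl1[of 2 n] assms by auto
  define l where "l = ln (real n) / ln 2"
  have "real (2 ^ k) \<le> real n" using k(1) by (simp only: of_nat_le_iff)
  then have kn: "2 ^ k \<le> real n" by simp
  then have "ln (2 ^ k) \<le> ln (real n)" using assms by (subst ln_le_cancel_iff) auto
  then have kl: "real k \<le> l" by (simp add: l_def ln_realpow field_simps)
  have l1: "1 \<le> l" using assms by (simp add: l_def)
  \<comment> \<open>The scale is the first power of two above n, hence at most 2 n, and k + 2 <= 3 l
    because l >= 1; this gives the 6.\<close>
  have "D * (real (k + 1) + 1) * 2 ^ (k + 1) \<le> D * (3 * l) * (2 * real n)"
    using kl l1 kn assms(2) by (intro mult_mono) auto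
  \<comment> \<open>Here the bound n ln n is relaxed by a further logarithm.\<close>
  also have "\<dots> \<le> D * (3 * l * l) * (2 * real n)"
    using l1 assms(2) by (intro mult_right_mono mult_left_mono) auto
  also have "\<dots> = 6 * D / (ln 2)\<^sup>2 * real n * (ln (real n))\<^sup>2"
    by (simp add: l_def power2_eq_square)
  finally show thesis using k(2) by (intro that[of "k + 1"]) auto
qed

lemma (in abelian_presentation) mean_dehn_bounds:
  "\<exists>K::real. \<forall>n\<ge>2. mean_dehn A R n \<le> K * real n * (ln (real n))\<^sup>2
           \<and> smean_dehn A R n \<le> K * real n * (ln (real n))\<^sup>2"
proof -
  obtain D :: int where D: "\<forall>n k. n \<le> 2 ^ k \<longrightarrow>
     (\<Sum>w\<in>null_sphere A R n. int (area A R w)) \<le> D * (int k + 1) * 2 ^ k * int (card (null_sphere A R n))"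
    using sum_area_null_sphere_le by blast
  \<comment> \<open>The integer D comes without a sign, whereas \<open>dyadic_scale_le\<close> asks
    for a nonnegative constant.\<close>
  let ?D = "max 0 (real_of_int D)"
  have avg: "(\<Sum>w\<in>U. real (area A R w)) / real (card U) \<le> ?D * (real k + 1) * 2 ^ k"
    if "(\<Sum>w\<in>U. int (area A R w)) \<le> D * (int k + 1) * 2 ^ k * int (card U)" for U k
  proof (cases "card U = 0")
    case False
    have "real_of_int (\<Sum>w\<in>U. int (area A R w)) \<le> real_of_int (D * (int k + 1) * 2 ^ k * int (card U))"
      using that by (simp only: of_int_le_iff)
    then have "(\<Sum>w\<in>U. real (area A R w)) \<le> real_of_int D * (real k + 1) * 2 ^ k * real (card U)" by simp
    also have "\<dots> \<le> ?D * (real k + 1) * 2 ^ k * real (card U)" by (intro mult_right_mono) auto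
    finally show ?thesis using False by (simp add: divide_le_eq)
  qed simp
  show ?thesis
  proof (intro exI[of _ "6 * ?D / (ln 2)\<^sup>2"] allI impI conjI)
    fix n :: nat assume n: "n \<ge> 2"
    obtain k where k: "n \<le> 2 ^ k" and le: "?D * (real k + 1) * 2 ^ k \<le> 6 * ?D / (ln 2)\<^sup>2 * real n * (ln (real n))\<^sup>2"
      by (rule dyadic_scale_le[OF n, of ?D]) auto
    show "mean_dehn A R n \<le> 6 * ?D / (ln 2)\<^sup>2 * real n * (ln (real n))\<^sup>2"
      unfolding mean_dehn_def using avg[OF sum_area_null_ball_le[OF D k]] le by (rule order_trans)
    have "(\<Sum>w\<in>null_sphere A R n. real (area A R w)) / real (card (null_sphere A R n)) \<le> ?D * (real k + 1) * 2 ^ k"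
      using D k by (intro avg) blast
    then show "smean_dehn A R n \<le> 6 * ?D / (ln 2)\<^sup>2 * real n * (ln (real n))\<^sup>2"
      unfolding smean_dehn_def using le by (auto intro: order_trans)
  qed
qed

section \<open>Transfer to a presentation of a given abelian group\<close>

theorem theorem1p1:
  fixes G :: "('g, 'm) monoid_scheme"
    and A :: "'a set"
    and R :: "'a letter list set"
  assumes "comm_group G"
    and "\<exists>S. finite S \<and> S \<subseteq> carrier G \<and> generate G S = carrier G"
    and "finite A"
    and "finite R"
    and "R \<subseteq> carrier (free_group A)"
    and "presented_group A R \<cong> G"
  shows "\<exists>K::real. \<forall>n\<ge>2. mean_dehn A R n \<le> K * real n * (ln (real n))\<^sup>2
           \<and> smean_dehn A R n \<le> K * real n * (ln (real n))\<^sup>2"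
proof -
  let ?F = "free_group A" and ?P = "presented_group A R"
  let ?N = "normal_closure ?F R"
  interpret F: group ?F by (rule group_free_group)
  interpret P: group ?P using assms(5) by (rule group_presented_group)
  interpret N: normal ?N ?F using normal_normal_closure[OF group_free_group assms(5)] .
  have "G \<cong> ?P" using assms(6) P.iso_sym by blast
  then interpret P: comm_group ?P
    using comm_group.iso_imp_comm_group[OF assms(1)] P.is_monoid by blast
  \<comment> \<open>In the commutative quotient xy and yx have the same coset, so xy = h yx with h
    in the normal closure, and h is the commutator.\<close>
  have "x \<otimes>\<^bsub>?F\<^esub> y \<otimes>\<^bsub>?F\<^esub> inv\<^bsub>?F\<^esub> x \<otimes>\<^bsub>?F\<^esub> inv\<^bsub>?F\<^esub> y \<in> ?N" if x: "x \<in> carrier ?F" and y: "y \<in> carrier ?F" for x y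
  proof -
    have "?N #>\<^bsub>?F\<^esub> x \<in> carrier ?P" "?N #>\<^bsub>?F\<^esub> y \<in> carrier ?P"
      using x y by (auto simp: presented_group_def FactGroup_def RCOSETS_def)
    from P.m_comm[OF this]
    have "?N #>\<^bsub>?F\<^esub> (x \<otimes>\<^bsub>?F\<^esub> y) = ?N #>\<^bsub>?F\<^esub> (y \<otimes>\<^bsub>?F\<^esub> x)"
      using x y by (simp add: presented_group_def FactGroup_def N.rcos_sum)
    then have "x \<otimes>\<^bsub>?F\<^esub> y \<in> ?N #>\<^bsub>?F\<^esub> (y \<otimes>\<^bsub>?F\<^esub> x)"
      using x y N.subgroup_axioms F.rcos_self[of "x \<otimes>\<^bsub>?F\<^esub> y" ?N] by simp
    then obtain h where h: "h \<in> ?N" "x \<otimes>\<^bsub>?F\<^esub> y = h \<otimes>\<^bsub>?F\<^esub> (y \<otimes>\<^bsub>?F\<^esub> x)"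
      by (auto simp: r_coset_def)
    have hc: "h \<in> carrier ?F" using h(1) N.subset by blast
    have "x \<otimes>\<^bsub>?F\<^esub> y \<otimes>\<^bsub>?F\<^esub> inv\<^bsub>?F\<^esub> x \<otimes>\<^bsub>?F\<^esub> inv\<^bsub>?F\<^esub> y = h"
      unfolding h(2) using x y hc by (simp add: F.m_assoc)
    then show ?thesis using h(1) by simp
  qed
  then interpret abelian_presentation A R
    using assms(3,5) by unfold_locales auto
  show ?thesis by (rule mean_dehn_bounds)
qed

end
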